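(* Fix $\alpha\in(0,1)$. Let $V_{jk}=\sum_{i=1}^{n} c_{ni}\, g\{R_{ni}^{jk}/(n+1)\}$ be simple linear rank statistics with $c_{ni}=n^{-1}f\{i/(n+1)\}$, and assume that $\sigma_V^2=A_1\{1+o(1)\}$ and $\max\{|f(0)|,|g(0)|\}\le A_2$ for some positive constants $A_1$ and $A_2$, and that $f(\cdot),g(\cdot)$ have bounded Lipschitz constants. Then for some large scalar $B_1$ depending only on $A_1,A_2$ and the Lipschitz constants of $f$ and $g$, $$\inf_{F(X)\in H_a^V(B_1)}\mathrm{pr}(T_\alpha=1)=1-o(1),$$ where the infimum is taken over all distributions $F(X)$ such that $V\{F(X)\}\in\mathcal U(B_1)$.
   Context: Setting: $X=(X_1,\ldots,X_d)^{\mathrm T}$ is a continuous random vector in $\mathbb{R}^d$ with joint distribution function $F(X)$, and $X_{1,\cdot},\ldots,X_{n,\cdot}$ are $n$ independent copies of $X$. The dimension $d=d_n$ may depend on $n$; both $n$ and $d$ tend to infinity. $H_0$: $X_1,\ldots,X_d$ are mutually independent. Relative ranks: $Q_{ni}^j$ is the rank of $X_{i,j}$ in $\{X_{1,j},\ldots,X_{n,j}\}$, and $R_{ni}^{jk}=Q_{ni'}^k$ where $i'$ is the index with $Q_{ni'}^j=i$. Under $H_0$ the distribution of $V_{jk}$ is free of the distribution of $X$ and of $(j,k)$; $E_{H_0},\mathrm{var}_{H_0}$ denote expectation and variance under $H_0$. Let $\sigma_V^2=n\,\mathrm{var}_{H_0}(V_{jk})$ and $L_n=\max_{j<k}|V_{jk}-E_{H_0}(V_{jk})|$.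 The test is $$T_\alpha=I\Big(\frac{nL_n^2}{\sigma_V^2}-4\log d+\log\log d\ge q_\alpha\Big),\qquad q_\alpha=-\log(8\pi)-2\log\log(1-\alpha)^{-1}.$$ Alternative: for a constant $c$, $$\mathcal U(c)=\Big\{M\in\mathbb{R}^{d\times d}:\mathrm{diag}(M)=I_d,\ M=M^{\mathrm T},\ \max_{1\le j<k\le d}|M_{jk}|\ge c(\log d/n)^{1/2}\Big\}.$$ The random matrix $\widehat V\in\mathbb{R}^{d\times d}$ has entries $\widehat V_{jk}=\widehat V_{kj}=\sigma_V^{-1}\{V_{jk}-E_{H_0}(V_{jk})\}$ for $j<k$ and $\widehat V_{\ell\ell}=1$; $V=V\{F(X)\}=E(\widehat V)$, expectation under the distribution $F(X)$; and $H_a^V(c)=\{F(X):V\{F(X)\}\in\mathcal U(c)\}$. *)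

theory Defs
  imports "HOL-Probability.Probability"
begin

(* A point of R^d is an extensional function on {1..d}; a sample x has rows x i for i in {1..n},
   so x i j is the j-th coordinate of the i-th observation. *)

type_synonym sample = "nat \<Rightarrow> nat \<Rightarrow> real"
type_synonym pair_stat = "sample \<Rightarrow> nat \<Rightarrow> nat \<Rightarrow> real"

definition joint_cdf :: "nat \<Rightarrow> (nat \<Rightarrow> real) measure \<Rightarrow> (nat \<Rightarrow> real) \<Rightarrow> real" where
  "joint_cdf d F y = measure F {x \<in> space F. \<forall>j\<in>{1..d}. x j \<le> y j}"

(* joint_cdf d F ignores coordinates outside {1..d}, so continuity in the product topology on
   nat => real is continuity on R^d. *)
definition continuous_laws :: "nat \<Rightarrow> (nat \<Rightarrow> real) measure set" where
  "continuous_laws d = {F. prob_space F \<and> sets F = sets (\<Pi>\<^sub>M j\<in>{1..d}. (borel :: real measure)) \<and>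
     continuous_on UNIV (joint_cdf d F)}"

definition null_laws :: "nat \<Rightarrow> (nat \<Rightarrow> real) measure set" where
  "null_laws d = {F \<in> continuous_laws d. prob_space.indep_vars F (\<lambda>_. borel) (\<lambda>j x. x j) {1..d}}"

definition sample_law :: "nat \<Rightarrow> (nat \<Rightarrow> real) measure \<Rightarrow> sample measure" where
  "sample_law n F = (\<Pi>\<^sub>M i\<in>{1..n}. F)"

definition obs_rank :: "nat \<Rightarrow> sample \<Rightarrow> nat \<Rightarrow> nat \<Rightarrow> nat" where
  "obs_rank n x j i = card {l \<in> {1..n}. x l j \<le> x i j}"

(* The index chosen by THE exists uniquely whenever column j has no ties, hence almost surely
   under a continuous law. *)
definition relative_rank :: "nat \<Rightarrow> sample \<Rightarrow> nat \<Rightarrow> nat \<Rightarrow> nat \<Rightarrow> nat" where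
  "relative_rank n x j k i = obs_rank n x k (THE i'. i' \<in> {1..n} \<and> obs_rank n x j i' = i)"

definition linear_rank_stat :: "(nat \<Rightarrow> real) \<Rightarrow> (real \<Rightarrow> real) \<Rightarrow> nat \<Rightarrow> pair_stat" where
  "linear_rank_stat c g n x j k =
     (\<Sum>i=1..n. c i * g (real (relative_rank n x j k i) / (real n + 1)))"

definition simple_linear_rank_stat :: "(real \<Rightarrow> real) \<Rightarrow> (real \<Rightarrow> real) \<Rightarrow> nat \<Rightarrow> pair_stat" where
  "simple_linear_rank_stat f g n = linear_rank_stat (\<lambda>i. f (real i / (real n + 1)) / real n) g n"

(* The common value under all null laws and all pairs of coordinates; for the statistics above
   this value exists, see null_mean_eq and null_var_eq below. *)
definition null_mean :: "nat \<Rightarrow> nat \<Rightarrow> pair_stat \<Rightarrow> real" where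
  "null_mean n d V = (THE m. \<forall>F\<in>null_laws d. \<forall>j k. 1 \<le> j \<and> j < k \<and> k \<le> d \<longrightarrow>
     prob_space.expectation (sample_law n F) (\<lambda>x. V x j k) = m)"

definition null_var :: "nat \<Rightarrow> nat \<Rightarrow> pair_stat \<Rightarrow> real" where
  "null_var n d V = (THE v. \<forall>F\<in>null_laws d. \<forall>j k. 1 \<le> j \<and> j < k \<and> k \<le> d \<longrightarrow>
     prob_space.variance (sample_law n F) (\<lambda>x. V x j k) = v)"

definition sigma2 :: "nat \<Rightarrow> nat \<Rightarrow> pair_stat \<Rightarrow> real" where
  "sigma2 n d V = real n * null_var n d V"

definition max_dev :: "nat \<Rightarrow> nat \<Rightarrow> pair_stat \<Rightarrow> sample \<Rightarrow> real" where
  "max_dev n d V x = Max {\<bar>V x j k - null_mean n d V\<bar> | j k. 1 \<le> j \<and> j < k \<and> k \<le> d}"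

definition crit :: "real \<Rightarrow> real" where
  "crit \<alpha> = - ln (8 * pi) - 2 * ln (ln (inverse (1 - \<alpha>)))"

definition rank_test :: "real \<Rightarrow> nat \<Rightarrow> nat \<Rightarrow> pair_stat \<Rightarrow> sample \<Rightarrow> nat" where
  "rank_test \<alpha> n d V x = of_bool
     (real n * (max_dev n d V x)\<^sup>2 / sigma2 n d V - 4 * ln (real d) + ln (ln (real d)) \<ge> crit \<alpha>)"

definition sparse_alternatives :: "real \<Rightarrow> nat \<Rightarrow> nat \<Rightarrow> (nat \<Rightarrow> nat \<Rightarrow> real) set" where
  "sparse_alternatives c n d = {M. (\<forall>l\<in>{1..d}. M l l = 1) \<and>
     (\<forall>j\<in>{1..d}. \<forall>k\<in>{1..d}. M j k = M k j) \<and>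
     Max {\<bar>M j k\<bar> | j k. 1 \<le> j \<and> j < k \<and> k \<le> d} \<ge> c * sqrt (ln (real d) / real n)}"

definition V_hat :: "nat \<Rightarrow> nat \<Rightarrow> pair_stat \<Rightarrow> sample \<Rightarrow> nat \<Rightarrow> nat \<Rightarrow> real" where
  "V_hat n d V x j k = (if j = k then 1
     else inverse (sqrt (sigma2 n d V)) * (V x (min j k) (max j k) - null_mean n d V))"

definition V_matrix :: "nat \<Rightarrow> nat \<Rightarrow> pair_stat \<Rightarrow> (nat \<Rightarrow> real) measure \<Rightarrow> nat \<Rightarrow> nat \<Rightarrow> real" where
  "V_matrix n d V F j k = prob_space.expectation (sample_law n F) (\<lambda>x. V_hat n d V x j k)"

definition alternative_laws :: "real \<Rightarrow> nat \<Rightarrow> nat \<Rightarrow> pair_stat \<Rightarrow> (nat \<Rightarrow> real) measure set" where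
  "alternative_laws c n d V = {F \<in> continuous_laws d. V_matrix n d V F \<in> sparse_alternatives c n d}"

definition test_power :: "real \<Rightarrow> nat \<Rightarrow> nat \<Rightarrow> pair_stat \<Rightarrow> (nat \<Rightarrow> real) measure \<Rightarrow> real" where
  "test_power \<alpha> n d V F =
     measure (sample_law n F) {x \<in> space (sample_law n F). rank_test \<alpha> n d V x = 1}"

(* Powers lie in [0,1]; inserting 1 makes this the infimum in [0,1], which is 1 when there is no
   alternative. Inf {} would be an unspecified real. *)
definition worst_power :: "real \<Rightarrow> real \<Rightarrow> nat \<Rightarrow> nat \<Rightarrow> pair_stat \<Rightarrow> real" where
  "worst_power \<alpha> c n d V = Inf (insert 1 (test_power \<alpha> n d V ` alternative_laws c n d V))"


lemma continuous_lawsD: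
  assumes "F \<in> continuous_laws d"
  shows "prob_space F" "sets F = sets (\<Pi>\<^sub>M j\<in>{1..d}. (borel :: real measure))"
    "space F = ({1..d} \<rightarrow>\<^sub>E UNIV)" "continuous_on UNIV (joint_cdf d F)"
  using assms sets_eq_imp_space_eq[of F "\<Pi>\<^sub>M j\<in>{1..d}. (borel :: real measure)"]
  by (auto simp: continuous_laws_def space_PiM)

lemma measurable_coord:
  assumes "F \<in> continuous_laws d"
  shows "(\<lambda>x. x j) \<in> borel_measurable F"
proof -
  have "(\<lambda>x. x j) \<in> borel_measurable (\<Pi>\<^sub>M j\<in>{1..d}. (borel :: real measure))"
  proof (cases "j \<in> {1..d}")
    case False
    have "x j = undefined" if "x \<in> space (\<Pi>\<^sub>M j\<in>{1..d}. (borel :: real measure))" for x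
      using that False by (simp only: space_PiM PiE_def extensional_def) blast
    then have "(\<lambda>x. x j) \<in> borel_measurable (\<Pi>\<^sub>M j\<in>{1..d}. (borel :: real measure)) \<longleftrightarrow>
      (\<lambda>x. undefined :: real) \<in> borel_measurable (\<Pi>\<^sub>M j\<in>{1..d}. (borel :: real measure))"
      by (intro measurable_cong) metis
    then show ?thesis by simp
  qed simp
  then show ?thesis
    using continuous_lawsD(2)[OF assms] measurable_cong_sets by blast
qed

lemma no_atoms:
  assumes F: "F \<in> continuous_laws d" and j: "j \<in> {1..d}"
  shows "measure F {x \<in> space F. x j = a} = 0"
proof -
  interpret prob_space F by (rule continuous_lawsD(1)[OF F])
  note [measurable] = measurable_coord[OF F]
  define y where "y = (\<lambda>(K::nat) (t::real) i. if i = j then t else real K)"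
  define A where "A = (\<lambda>K::nat. {x \<in> space F. x j = a \<and> (\<forall>i\<in>{1..d}. i \<noteq> j \<longrightarrow> x i \<le> real K)})"
  have A0: "measure F (A K) = 0" for K
  proof -
    have c: "continuous_on UNIV (\<lambda>t. joint_cdf d F (y K t))"
    proof -
      have "continuous_on UNIV (\<lambda>t. y K t i)" for i
        by (cases "i = j") (simp_all add: y_def)
      then have "continuous_on UNIV (y K)"
        by (rule continuous_on_coordinatewise_then_product)
      then show ?thesis
        using continuous_on_compose2[OF continuous_lawsD(4)[OF F]] by blast
    qed
    have "isCont (\<lambda>t. joint_cdf d F (y K t)) a"
      using c by (simp add: continuous_on_eq_continuous_at)
    then have "(\<lambda>m. joint_cdf d F (y K (a - inverse (real (Suc m))))) \<longlonglongrightarrow> joint_cdf d F (y K a)"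
      using LIMSEQ_inverse_real_of_nat_add_minus[of a]
      by (auto intro: isCont_tendsto_compose)
    then have lim: "(\<lambda>m. joint_cdf d F (y K a) - joint_cdf d F (y K (a - inverse (real (Suc m))))) \<longlonglongrightarrow> 0"
      using tendsto_diff[OF tendsto_const[of "joint_cdf d F (y K a)"]] by fastforce
    have "measure F (A K) \<le> joint_cdf d F (y K a) - joint_cdf d F (y K (a - inverse (real (Suc m))))" for m
    proof -
      let ?e = "inverse (real (Suc m))"
      let ?C = "\<lambda>t. {x \<in> space F. \<forall>i\<in>{1..d}. x i \<le> y K t i}"
      have "A K \<subseteq> ?C a - ?C (a - ?e)"
        using j by (auto simp: A_def y_def simp del: of_nat_Suc intro!: bexI[of _ j])
      then have "measure F (A K) \<le> measure F (?C a - ?C (a - ?e))"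
        by (intro finite_measure_mono) auto
      also have "\<dots> = measure F (?C a) - measure F (?C (a - ?e))"
      proof (rule finite_measure_Diff)
        have "a - ?e \<le> a" by simp
        then have "y K (a - ?e) i \<le> y K a i" for i by (simp only: y_def split: if_split) simp
        then show "?C (a - ?e) \<subseteq> ?C a" using order_trans by blast
      qed measurable
      finally show ?thesis by (simp add: joint_cdf_def)
    qed
    then have "measure F (A K) \<le> 0"
      using lim by (intro LIMSEQ_le_const[OF lim]) auto
    then show ?thesis by (simp add: measure_le_0_iff)
  qed
  have "(\<lambda>K. measure F (A K)) \<longlonglongrightarrow> measure F (\<Union>K. A K)"
  proof (rule finite_Lim_measure_incseq)
    show "range A \<subseteq> sets F" unfolding A_def by (intro image_subsetI) measurable
    have "A K \<subseteq> A K'" if "K \<le> K'" for K K'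
    proof -
      have "real K \<le> real K'" using that by simp
      then show ?thesis unfolding A_def using order_trans by blast
    qed
    then show "incseq A" by (simp add: incseq_def)
  qed
  then have "measure F (\<Union>K. A K) = 0"
    by (simp add: A0 LIMSEQ_const_iff)
  moreover have "(\<Union>K. A K) = {x \<in> space F. x j = a}"
  proof (intro equalityI subsetI)
    fix x assume x: "x \<in> {x \<in> space F. x j = a}"
    obtain K where "Max (insert 0 (x ` {1..d})) \<le> real K" using real_arch_simple by blast
    moreover have "x i \<le> Max (insert 0 (x ` {1..d}))" if "i \<in> {1..d}" for i
      using that by (intro Max_ge) auto
    ultimately have "x i \<le> real K" if "i \<in> {1..d}" for i using that order_trans by blast
    then have "x \<in> A K" using x unfolding A_def by blast
    then show "x \<in> (\<Union>K. A K)" by blast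
  qed (auto simp: A_def)
  ultimately show ?thesis by simp
qed

lemma prob_space_sample_law:
  assumes "F \<in> continuous_laws d"
  shows "prob_space (sample_law n F)"
  unfolding sample_law_def by (intro prob_space_PiM continuous_lawsD(1)[OF assms])

lemma measurable_entry:
  assumes "F \<in> continuous_laws d"
  shows "(\<lambda>x. x i j) \<in> borel_measurable (sample_law n F)"
proof (cases "i \<in> {1..n}")
  case True
  then show ?thesis
    unfolding sample_law_def
    by (intro measurable_compose[OF measurable_component_singleton[of i "{1..n}" "\<lambda>_. F"]
        measurable_coord[OF assms, of j]])
next
  case False
  have "x i j = undefined j" if "x \<in> space (sample_law n F)" for x
  proof -
    have "x i = undefined"
      using that False unfolding sample_law_def by (simp only: space_PiM PiE_def extensional_def) blast
    then show ?thesis by simp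
  qed
  then have "(\<lambda>x. x i j) \<in> borel_measurable (sample_law n F) \<longleftrightarrow>
      (\<lambda>x. undefined j :: real) \<in> borel_measurable (sample_law n F)"
    by (intro measurable_cong) metis
  then show ?thesis by simp
qed

lemma obs_rank_le: "obs_rank n x j i \<le> n"
proof -
  have "card {l \<in> {1..n}. x l j \<le> x i j} \<le> card {1..n}" by (intro card_mono) auto
  then show ?thesis by (simp add: obs_rank_def)
qed

lemma measurable_obs_rank:
  assumes "F \<in> continuous_laws d"
  shows "(\<lambda>x. obs_rank n x j i) \<in> measurable (sample_law n F) (count_space UNIV)"
proof -
  note [measurable] = measurable_entry[OF assms]
  have "(\<lambda>x. \<Sum>l=1..n. if x l j \<le> x i j then 1 else (0::nat)) \<in>
      measurable (sample_law n F) (count_space UNIV)"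
    by measurable
  moreover have "obs_rank n x j i = (\<Sum>l=1..n. if x l j \<le> x i j then 1 else (0::nat))" for x
    by (simp add: obs_rank_def sum.If_cases Int_def)
  ultimately show ?thesis by simp
qed

lemma measurable_relative_rank:
  assumes "F \<in> continuous_laws d"
  shows "(\<lambda>x. relative_rank n x j k i) \<in> measurable (sample_law n F) (count_space UNIV)"
proof -
  have "(\<lambda>x. {i' \<in> {1..n}. obs_rank n x j i' = i}) \<in>
      measurable (sample_law n F) (count_space (Pow {1..n}))"
  proof (subst measurable_count_space_eq2, simp, safe)
    fix A assume A: "A \<subseteq> {1..n}"
    have "(\<lambda>x. {i' \<in> {1..n}. obs_rank n x j i' = i}) -` {A} \<inter> space (sample_law n F) =
       {x \<in> space (sample_law n F). \<forall>i'\<in>{1..n}. obs_rank n x j i' = i \<longleftrightarrow> i' \<in> A}"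
    proof -
      have "{i' \<in> {1..n}. P i'} = A \<longleftrightarrow> (\<forall>i'\<in>{1..n}. P i' \<longleftrightarrow> i' \<in> A)" for P
        using A by blast
      then show ?thesis by (simp add: vimage_def Int_def conj_commute)
    qed
    also have "\<dots> \<in> sets (sample_law n F)"
    proof (rule sets.sets_Collect_finite_All[where P = "\<lambda>i' x. obs_rank n x j i' = i \<longleftrightarrow> i' \<in> A"])
      fix i'
      have "(\<lambda>x. obs_rank n x j i') -` {m. m = i \<longleftrightarrow> i' \<in> A} \<inter> space (sample_law n F)
          \<in> sets (sample_law n F)"
        by (rule measurable_sets[OF measurable_obs_rank[OF assms]]) simp
      then show "{x \<in> space (sample_law n F). obs_rank n x j i' = i \<longleftrightarrow> i' \<in> A}
          \<in> sets (sample_law n F)"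
        by (simp add: vimage_def Int_def conj_commute)
    qed simp
    finally show "(\<lambda>x. {i' \<in> {1..n}. obs_rank n x j i' = i}) -` {A} \<inter> space (sample_law n F)
      \<in> sets (sample_law n F)" .
  qed
  then have "(\<lambda>x. obs_rank n x k (The (\<lambda>i'. i' \<in> {i' \<in> {1..n}. obs_rank n x j i' = i}))) \<in>
      measurable (sample_law n F) (count_space UNIV)"
    by (intro measurable_compose_countable'[where I = "Pow {1..n}"
          and f = "\<lambda>A x. obs_rank n x k (The (\<lambda>i'. i' \<in> A))"
          and g = "\<lambda>x. {i' \<in> {1..n}. obs_rank n x j i' = i}"])
       (auto simp: countable_finite measurable_obs_rank[OF assms])
  then show ?thesis by (simp add: relative_rank_def)
qed

lemma measurable_linear_rank_stat:
  assumes "F \<in> continuous_laws d"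
  shows "(\<lambda>x. linear_rank_stat c g n x j k) \<in> borel_measurable (sample_law n F)"
proof -
  have "(\<lambda>x. c i * g (real (relative_rank n x j k i) / (real n + 1))) \<in> borel_measurable (sample_law n F)" for i
    by (rule measurable_compose[OF measurable_relative_rank[OF assms]]) simp
  then show ?thesis
    unfolding linear_rank_stat_def by (rule borel_measurable_sum)
qed

lemma finite_range_linear_rank_stat: "finite (range (\<lambda>x. linear_rank_stat c g n x j k))"
proof (rule finite_subset)
  show "range (\<lambda>x. linear_rank_stat c g n x j k) \<subseteq>
      (\<lambda>r. \<Sum>i=1..n. c i * g (real (r i) / (real n + 1))) ` ({1..n} \<rightarrow>\<^sub>E {..n})"
  proof safe
    fix x
    show "linear_rank_stat c g n x j k \<in>
      (\<lambda>r. \<Sum>i=1..n. c i * g (real (r i) / (real n + 1))) ` ({1..n} \<rightarrow>\<^sub>E {..n})"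
      by (rule image_eqI[of _ _ "restrict (relative_rank n x j k) {1..n}"])
         (auto simp: linear_rank_stat_def relative_rank_def obs_rank_le)
  qed
qed (simp add: finite_PiE)

definition no_ties :: "nat \<Rightarrow> nat \<Rightarrow> sample \<Rightarrow> bool" where
  "no_ties n j x \<longleftrightarrow> inj_on (\<lambda>i. x i j) {1..n}"

lemma AE_no_ties:
  assumes F: "F \<in> continuous_laws d" and j: "j \<in> {1..d}"
  shows "AE x in sample_law n F. no_ties n j x"
proof -
  interpret F: prob_space F by (rule continuous_lawsD(1)[OF F])
  interpret FF: pair_sigma_finite F F by standard
  interpret F': product_sigma_finite "\<lambda>_::nat. F" by standard
  note [measurable] = measurable_coord[OF F]
  have "AE x in sample_law n F. x l j \<noteq> x m j" if lm: "l \<in> {1..n}" "m \<in> {1..n}" "l \<noteq> m" for l m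
  proof -
    have "AE y in F. AE z in F. y j \<noteq> z j"
    proof (rule AE_I2)
      fix y
      have "{z \<in> space F. z j = y j} \<in> null_sets F"
        using no_atoms[OF F j, of "y j"] by (auto simp: null_sets_def F.emeasure_eq_measure)
      then show "AE z in F. y j \<noteq> z j"
        by (rule AE_I') auto
    qed
    then have ae: "AE p in F \<Otimes>\<^sub>M F. fst p j \<noteq> snd p j"
    proof (intro FF.AE_pair_measure)
      show "{p \<in> space (F \<Otimes>\<^sub>M F). fst p j \<noteq> snd p j} \<in> sets (F \<Otimes>\<^sub>M F)"
        by measurable
    qed simp
    have [measurable]: "(\<lambda>x. (x l, x m)) \<in> measurable (sample_law n F) (F \<Otimes>\<^sub>M F)"
      using lm unfolding sample_law_def by measurable
    have "F \<Otimes>\<^sub>M F = distr (sample_law n F) (F \<Otimes>\<^sub>M F) (\<lambda>x. (x l, x m))"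
    proof (rule pair_measure_eqI)
      fix A B assume AB: "A \<in> sets F" "B \<in> sets F"
      let ?C = "\<lambda>i. if i = l then A else if i = m then B else space F"
      have "(\<lambda>x. (x l, x m)) -` (A \<times> B) \<inter> space (sample_law n F) = (\<Pi>\<^sub>E i\<in>{1..n}. ?C i)"
      proof (intro equalityI subsetI)
        fix x assume "x \<in> (\<lambda>x. (x l, x m)) -` (A \<times> B) \<inter> space (sample_law n F)"
        then have x: "x l \<in> A" "x m \<in> B" "x \<in> {1..n} \<rightarrow>\<^sub>E space F"
          by (simp_all add: sample_law_def space_PiM)
        then show "x \<in> (\<Pi>\<^sub>E i\<in>{1..n}. ?C i)"
          unfolding PiE_iff by simp
      next
        fix x assume x: "x \<in> (\<Pi>\<^sub>E i\<in>{1..n}. ?C i)"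
        moreover have "(\<Pi>\<^sub>E i\<in>{1..n}. ?C i) \<subseteq> {1..n} \<rightarrow>\<^sub>E space F"
          by (rule PiE_mono) (use AB[THEN sets.sets_into_space] in \<open>simp split: if_split\<close>)
        ultimately have "x \<in> {1..n} \<rightarrow>\<^sub>E space F" by blast
        moreover have "x l \<in> A" "x m \<in> B"
          using PiE_mem[OF x lm(1)] PiE_mem[OF x lm(2)] lm(3) by simp_all
        ultimately show "x \<in> (\<lambda>x. (x l, x m)) -` (A \<times> B) \<inter> space (sample_law n F)"
          by (simp add: sample_law_def space_PiM)
      qed
      then have "emeasure (distr (sample_law n F) (F \<Otimes>\<^sub>M F) (\<lambda>x. (x l, x m))) (A \<times> B) =
          emeasure (sample_law n F) (\<Pi>\<^sub>E i\<in>{1..n}. ?C i)"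
        using AB by (subst emeasure_distr) auto
      also have "\<dots> = (\<Prod>i=1..n. emeasure F (?C i))"
        using AB unfolding sample_law_def by (intro F'.emeasure_PiM) auto
      also have "\<dots> = (\<Prod>i\<in>{l, m}. emeasure F (?C i))"
        using lm by (intro prod.mono_neutral_right) (auto simp: F.emeasure_space_1)
      finally show "emeasure F A * emeasure F B =
          emeasure (distr (sample_law n F) (F \<Otimes>\<^sub>M F) (\<lambda>x. (x l, x m))) (A \<times> B)"
        using lm(3) by simp
    qed (simp_all add: F.sigma_finite_measure_axioms)
    then have eq: "distr (sample_law n F) (F \<Otimes>\<^sub>M F) (\<lambda>x. (x l, x m)) = F \<Otimes>\<^sub>M F" by simp
    have "AE p in distr (sample_law n F) (F \<Otimes>\<^sub>M F) (\<lambda>x. (x l, x m)). fst p j \<noteq> snd p j"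
      using ae by (subst eq)
    then have "AE x in sample_law n F. fst (x l, x m) j \<noteq> snd (x l, x m) j"
      by (rule AE_distrD[rotated]) measurable
    then show ?thesis by simp
  qed
  then have "AE x in sample_law n F. \<forall>l\<in>{1..n}. \<forall>m\<in>{1..n}. l \<noteq> m \<longrightarrow> x l j \<noteq> x m j"
    by (intro AE_ball_countable[THEN iffD2] ballI AE_impI countable_finite finite_atLeastAtMost) blast
  then show ?thesis
    by eventually_elim (auto simp: no_ties_def inj_on_def)
qed


lemma obs_rank_less:
  assumes "i' \<in> {1..n}" "x i j < x i' j"
  shows "obs_rank n x j i < obs_rank n x j i'"
  unfolding obs_rank_def
proof (rule psubset_card_mono)
  show "{l \<in> {1..n}. x l j \<le> x i j} \<subset> {l \<in> {1..n}. x l j \<le> x i' j}"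
  proof
    show "{l \<in> {1..n}. x l j \<le> x i j} \<subseteq> {l \<in> {1..n}. x l j \<le> x i' j}" using assms by auto
    show "{l \<in> {1..n}. x l j \<le> x i j} \<noteq> {l \<in> {1..n}. x l j \<le> x i' j}"
      using assms by (metis (mono_tags, lifting) linorder_not_less mem_Collect_eq order_refl)
  qed
qed simp

lemma bij_betw_obs_rank:
  assumes "no_ties n j x"
  shows "bij_betw (obs_rank n x j) {1..n} {1..n}"
proof -
  have inj: "inj_on (obs_rank n x j) {1..n}"
  proof (rule inj_onI, rule ccontr)
    fix i i' assume *: "i \<in> {1..n}" "i' \<in> {1..n}" "obs_rank n x j i = obs_rank n x j i'" "i \<noteq> i'"
    then have "x i j \<noteq> x i' j" using inj_onD[OF assms[unfolded no_ties_def]] by blast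
    then show False
      using obs_rank_less[of i' n x i j] obs_rank_less[of i n x i' j] * by linarith
  qed
  have "obs_rank n x j i \<in> {1..n}" if "i \<in> {1..n}" for i
  proof -
    have "i \<in> {l \<in> {1..n}. x l j \<le> x i j}" using that by simp
    then have "obs_rank n x j i > 0"
      unfolding obs_rank_def by (subst card_gt_0_iff) (intro conjI, blast, simp)
    then show ?thesis using obs_rank_le[of n x j i] by auto
  qed
  then show ?thesis
    using inj by (simp add: bij_betw_def endo_inj_surj image_subset_iff)
qed

definition rank_perm :: "nat \<Rightarrow> sample \<Rightarrow> nat \<Rightarrow> nat \<Rightarrow> nat" where
  "rank_perm n x j i = (if i \<in> {1..n} then obs_rank n x j i else i)"

lemma rank_perm_permutes:
  assumes "no_ties n j x"
  shows "rank_perm n x j permutes {1..n}"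
proof (rule bij_imp_permutes)
  show "bij_betw (rank_perm n x j) {1..n} {1..n}"
    using bij_betw_obs_rank[OF assms] by (rule bij_betw_cong[THEN iffD1, rotated]) (simp add: rank_perm_def)
qed (simp add: rank_perm_def del: atLeastAtMost_iff)

lemma relative_rank_eq:
  assumes "no_ties n j x" "i \<in> {1..n}"
  shows "relative_rank n x j k i = rank_perm n x k (inv (rank_perm n x j) i)"
proof -
  note p = rank_perm_permutes[OF assms(1)]
  let ?i = "inv (rank_perm n x j) i"
  have i: "?i \<in> {1..n}" using permutes_in_image[OF permutes_inv[OF p]] assms(2) by blast
  have "(THE i'. i' \<in> {1..n} \<and> obs_rank n x j i' = i) = ?i"
  proof (rule the_equality)
    show "?i \<in> {1..n} \<and> obs_rank n x j ?i = i"
      using i permutes_inverses(1)[OF p, of i] by (simp add: rank_perm_def)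
    fix i' assume "i' \<in> {1..n} \<and> obs_rank n x j i' = i"
    then have "rank_perm n x j i' = i" by (simp add: rank_perm_def)
    then show "i' = ?i" using permutes_inverses(2)[OF p, of i'] by simp
  qed
  then show ?thesis using i by (simp add: relative_rank_def rank_perm_def)
qed

definition permute_column :: "nat \<Rightarrow> nat \<Rightarrow> nat \<Rightarrow> (nat \<Rightarrow> nat) \<Rightarrow> sample \<Rightarrow> sample" where
  "permute_column n d k \<sigma> x = (\<lambda>i\<in>{1..n}. \<lambda>j\<in>{1..d}. if j = k then x (\<sigma> i) j else x i j)"

lemma rank_perm_permute_column:
  assumes "\<sigma> permutes {1..n}" "k \<in> {1..d}"
  shows "rank_perm n (permute_column n d k \<sigma> x) k = rank_perm n x k \<circ> \<sigma>"
proof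
  fix i
  show "rank_perm n (permute_column n d k \<sigma> x) k i = (rank_perm n x k \<circ> \<sigma>) i"
  proof (cases "i \<in> {1..n}")
    case True
    have "bij_betw \<sigma> {l \<in> {1..n}. x (\<sigma> l) k \<le> x (\<sigma> i) k} {l \<in> {1..n}. x l k \<le> x (\<sigma> i) k}"
    proof (rule bij_betw_imageI)
      show "inj_on \<sigma> {l \<in> {1..n}. x (\<sigma> l) k \<le> x (\<sigma> i) k}"
        by (rule inj_on_subset[OF permutes_inj[OF assms(1)]]) simp
      have "l \<in> \<sigma> ` {l \<in> {1..n}. x (\<sigma> l) k \<le> x (\<sigma> i) k}" if "l \<in> {1..n}" "x l k \<le> x (\<sigma> i) k" for l
      proof -
        have "\<sigma> (inv \<sigma> l) = l" by (rule permutes_inverses(1)[OF assms(1)])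
        moreover have "inv \<sigma> l \<in> {1..n}"
          using permutes_in_image[OF permutes_inv[OF assms(1)]] that(1) by blast
        ultimately show ?thesis using that(2) by (intro image_eqI[of _ _ "inv \<sigma> l"]) simp_all
      qed
      then show "\<sigma> ` {l \<in> {1..n}. x (\<sigma> l) k \<le> x (\<sigma> i) k} = {l \<in> {1..n}. x l k \<le> x (\<sigma> i) k}"
        using permutes_in_image[OF assms(1)] by blast
    qed
    then have "card {l \<in> {1..n}. x (\<sigma> l) k \<le> x (\<sigma> i) k} = card {l \<in> {1..n}. x l k \<le> x (\<sigma> i) k}"
      by (rule bij_betw_same_card)
    moreover have "{l \<in> {1..n}. permute_column n d k \<sigma> x l k \<le> permute_column n d k \<sigma> x i k} =
        {l \<in> {1..n}. x (\<sigma> l) k \<le> x (\<sigma> i) k}"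
      using True assms(2) by (auto simp: permute_column_def)
    moreover have "\<sigma> i \<in> {1..n}" using True permutes_in_image[OF assms(1)] by blast
    ultimately show ?thesis using True by (simp add: rank_perm_def obs_rank_def)
  next
    case False
    then show ?thesis
      using permutes_not_in[OF assms(1) False] by (simp add: rank_perm_def del: atLeastAtMost_iff)
  qed
qed

lemma sum_permute_column:
  fixes \<Phi> :: "real \<Rightarrow> real"
  assumes "no_ties n j x" "no_ties n k x" "j \<in> {1..d}" "k \<in> {1..d}" "j \<noteq> k"
  shows "(\<Sum>\<sigma> | \<sigma> permutes {1..n}. \<Phi> (linear_rank_stat c g n (permute_column n d k \<sigma> x) j k)) =
    (\<Sum>\<pi> | \<pi> permutes {1..n}. \<Phi> (\<Sum>i=1..n. c i * g (real (\<pi> i) / (real n + 1))))"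
proof -
  let ?H = "\<lambda>\<pi>::nat \<Rightarrow> nat. \<Phi> (\<Sum>i=1..n. c i * g (real (\<pi> i) / (real n + 1)))"
  let ?p = "rank_perm n x j" and ?q = "rank_perm n x k"
  have "\<Phi> (linear_rank_stat c g n (permute_column n d k \<sigma> x) j k) = ?H (?q \<circ> (\<sigma> \<circ> inv ?p))"
    if s: "\<sigma> permutes {1..n}" for \<sigma>
  proof -
    let ?x = "permute_column n d k \<sigma> x"
    have e: "?x i j = x i j" if "i \<in> {1..n}" for i
      using that assms(3,5) by (simp add: permute_column_def)
    have nt: "no_ties n j ?x"
      using assms(1) inj_on_cong[of "{1..n}" "\<lambda>i. ?x i j" "\<lambda>i. x i j", OF e]
      by (simp add: no_ties_def)
    have "rank_perm n ?x j = ?p"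
    proof
      fix i
      have "{l \<in> {1..n}. ?x l j \<le> ?x i j} = {l \<in> {1..n}. x l j \<le> x i j}" if "i \<in> {1..n}"
        using e that by (intro Collect_cong conj_cong refl) metis
      then show "rank_perm n ?x j i = ?p i"
        by (simp add: rank_perm_def obs_rank_def del: atLeastAtMost_iff)
    qed
    then have "relative_rank n ?x j k i = (?q \<circ> (\<sigma> \<circ> inv ?p)) i" if "i \<in> {1..n}" for i
      using relative_rank_eq[OF nt that] rank_perm_permute_column[OF s assms(4), of x] by simp
    then show ?thesis by (simp add: linear_rank_stat_def)
  qed
  then have "(\<Sum>\<sigma> | \<sigma> permutes {1..n}. \<Phi> (linear_rank_stat c g n (permute_column n d k \<sigma> x) j k)) =
      (\<Sum>\<sigma> | \<sigma> permutes {1..n}. ?H (?q \<circ> (\<sigma> \<circ> inv ?p)))"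
    by (intro sum.cong) auto
  also have "\<dots> = (\<Sum>\<sigma> | \<sigma> permutes {1..n}. ?H (?q \<circ> \<sigma>))"
    by (rule sum_permutations_compose_right[symmetric, where f = "\<lambda>\<sigma>. ?H (?q \<circ> \<sigma>)"])
       (intro permutes_inv rank_perm_permutes assms)
  also have "\<dots> = (\<Sum>\<sigma> | \<sigma> permutes {1..n}. ?H \<sigma>)"
    by (rule setum_permutations_compose_left[symmetric, where f = ?H])
       (intro rank_perm_permutes assms)
  finally show ?thesis .
qed

lemma null_law_eq_PiM:
  assumes "F \<in> null_laws d" "d \<ge> 1"
  shows "F = (\<Pi>\<^sub>M j\<in>{1..d}. distr F borel (\<lambda>x. x j))"
proof -
  have F: "F \<in> continuous_laws d" and ind: "prob_space.indep_vars F (\<lambda>_. borel) (\<lambda>j x. x j) {1..d}"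
    using assms by (auto simp: null_laws_def)
  interpret prob_space F by (rule continuous_lawsD(1)[OF F])
  have "distr F (\<Pi>\<^sub>M j\<in>{1..d}. borel) (\<lambda>x. \<lambda>j\<in>{1..d}. x j) = (\<Pi>\<^sub>M j\<in>{1..d}. distr F borel (\<lambda>x. x j))"
    using ind assms(2) measurable_coord[OF F] by (subst (asm) indep_vars_iff_distr_eq_PiM') auto
  moreover have "distr F (\<Pi>\<^sub>M j\<in>{1..d}. borel) (\<lambda>x. \<lambda>j\<in>{1..d}. x j) = distr F F (\<lambda>x. x)"
    by (rule distr_cong) (use continuous_lawsD(2,3)[OF F] in \<open>auto simp: PiE_def extensional_restrict\<close>)
  ultimately show ?thesis by simp
qed

lemma distr_permute_column:
  assumes F: "F \<in> null_laws d" and d: "d \<ge> 1" and s: "\<sigma> permutes {1..n}"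
  shows "permute_column n d k \<sigma> \<in> measurable (sample_law n F) (sample_law n F)"
    and "distr (sample_law n F) (sample_law n F) (permute_column n d k \<sigma>) = sample_law n F"
proof -
  have Fc: "F \<in> continuous_laws d" using F by (simp add: null_laws_def)
  interpret F: prob_space F by (rule continuous_lawsD(1)[OF Fc])
  define \<mu> where "\<mu> = (\<lambda>j. distr F borel (\<lambda>x. x j))"
  have mu: "prob_space (\<mu> j)" "sets (\<mu> j) = sets borel" for j
    unfolding \<mu>_def using F.prob_space_distr[OF measurable_coord[OF Fc]] by auto
  have FM: "F = PiM {1..d} \<mu>" using null_law_eq_PiM[OF F d] by (simp add: \<mu>_def)
  let ?S = "sample_law n F" and ?I = "{1..n} \<times> {1..d}"
  let ?P = "\<Pi>\<^sub>M p\<in>?I. \<mu> (snd p)"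
  define unc where "unc = (\<lambda>x::sample. \<lambda>p\<in>?I. x (fst p) (snd p))"
  define cur where "cur = (\<lambda>z::nat \<times> nat \<Rightarrow> real. \<lambda>i\<in>{1..n}. \<lambda>j\<in>{1..d}. z (i, j))"
  define f where "f = (\<lambda>p. (if snd p = k then \<sigma> (fst p) else fst p, snd p))"
  define re where "re = (\<lambda>z::nat \<times> nat \<Rightarrow> real. \<lambda>p\<in>?I. z (f p))"
  have fI: "f p \<in> ?I" if "p \<in> ?I" for p
  proof -
    have "\<sigma> (fst p) \<in> {1..n}" "fst p \<in> {1..n}" "snd p \<in> {1..d}"
      using that permutes_in_image[OF s, of "fst p"] by (simp_all add: mem_Times_iff del: atLeastAtMost_iff)
    then show ?thesis by (simp add: f_def mem_Times_iff del: atLeastAtMost_iff)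
  qed
  have entry: "(\<lambda>x. x i j) \<in> measurable ?S (\<mu> j)" for i j
    using measurable_entry[OF Fc, of i j n] measurable_cong_sets[OF refl mu(2), of ?S j] by blast
  have m_unc: "unc \<in> measurable ?S ?P"
    unfolding unc_def by (rule measurable_restrict) (rule entry)
  have m_cur: "cur \<in> measurable ?P ?S"
    unfolding cur_def sample_law_def
  proof (rule measurable_restrict)
    fix i assume i: "i \<in> {1..n}"
    have "(\<lambda>z. \<lambda>j\<in>{1..d}. z (i, j)) \<in> measurable ?P (PiM {1..d} \<mu>)"
    proof (rule measurable_restrict)
      fix j assume "j \<in> {1..d}"
      then show "(\<lambda>z. z (i, j)) \<in> measurable ?P (\<mu> j)"
        using i measurable_component_singleton[of "(i, j)" ?I "\<lambda>p. \<mu> (snd p)"] by simp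
    qed
    then show "(\<lambda>z. \<lambda>j\<in>{1..d}. z (i, j)) \<in> measurable ?P F" by (simp only: FM[symmetric])
  qed
  have m_re: "re \<in> measurable ?P ?P"
    unfolding re_def
  proof (rule measurable_restrict)
    fix p assume "p \<in> ?I"
    then show "(\<lambda>z. z (f p)) \<in> measurable ?P (\<mu> (snd p))"
      using measurable_component_singleton[OF fI, of p "\<lambda>p. \<mu> (snd p)"] by (simp add: f_def)
  qed
  have m_T: "permute_column n d k \<sigma> \<in> measurable ?S ?S"
  proof -
    have "permute_column n d k \<sigma> = (\<lambda>x. \<lambda>i\<in>{1..n}. \<lambda>j\<in>{1..d}. x (if j = k then \<sigma> i else i) j)"
      by (auto simp: permute_column_def fun_eq_iff restrict_def)
    moreover have "(\<lambda>x. \<lambda>i\<in>{1..n}. \<lambda>j\<in>{1..d}. x (if j = k then \<sigma> i else i) j) \<in> measurable ?S (\<Pi>\<^sub>M i\<in>{1..n}. F)"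
    proof (rule measurable_restrict)
      fix i
      have "(\<lambda>x. \<lambda>j\<in>{1..d}. x (if j = k then \<sigma> i else i) j) \<in> measurable ?S (PiM {1..d} \<mu>)"
        by (rule measurable_restrict) (rule entry)
      then show "(\<lambda>x. \<lambda>j\<in>{1..d}. x (if j = k then \<sigma> i else i) j) \<in> measurable ?S F"
        by (simp only: FM[symmetric])
    qed
    ultimately show ?thesis by (simp add: sample_law_def)
  qed
  interpret FP: product_sigma_finite \<mu>
    by (intro product_sigma_finite.intro prob_space_imp_sigma_finite mu)
  interpret FF: product_sigma_finite "\<lambda>_::nat. F" by standard
  interpret PP: product_sigma_finite "\<lambda>p::nat \<times> nat. \<mu> (snd p)"
    by (intro product_sigma_finite.intro prob_space_imp_sigma_finite mu)
  have dP: "distr ?S ?P unc = ?P"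
  proof (rule PP.PiM_eqI)
    fix A assume A: "\<And>p. p \<in> ?I \<Longrightarrow> A p \<in> sets (\<mu> (snd p))"
    have spS: "space ?S = ({1..n} \<rightarrow>\<^sub>E ({1..d} \<rightarrow>\<^sub>E UNIV))"
      by (simp add: sample_law_def space_PiM continuous_lawsD(3)[OF Fc])
    have "unc -` (Pi\<^sub>E ?I A) \<inter> space ?S = (\<Pi>\<^sub>E i\<in>{1..n}. \<Pi>\<^sub>E j\<in>{1..d}. A (i, j))"
      unfolding spS unc_def by (auto simp: PiE_iff)
    then have "emeasure (distr ?S ?P unc) (Pi\<^sub>E ?I A) =
        emeasure ?S (\<Pi>\<^sub>E i\<in>{1..n}. \<Pi>\<^sub>E j\<in>{1..d}. A (i, j))"
      using A m_unc by (subst emeasure_distr) (auto intro!: sets_PiM_I_finite)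
    also have "\<dots> = (\<Prod>i=1..n. emeasure F (\<Pi>\<^sub>E j\<in>{1..d}. A (i, j)))"
    proof -
      have "(\<Pi>\<^sub>E j\<in>{1..d}. A (i, j)) \<in> sets F" if "i \<in> {1..n}" for i
        by (subst FM) (use A that in \<open>auto intro!: sets_PiM_I_finite\<close>)
      then show ?thesis unfolding sample_law_def by (intro FF.emeasure_PiM) auto
    qed
    also have "\<dots> = (\<Prod>i=1..n. \<Prod>j=1..d. emeasure (\<mu> j) (A (i, j)))"
    proof (rule prod.cong[OF refl])
      fix i assume i: "i \<in> {1..n}"
      have "emeasure (PiM {1..d} \<mu>) (\<Pi>\<^sub>E j\<in>{1..d}. A (i, j)) = (\<Prod>j=1..d. emeasure (\<mu> j) (A (i, j)))"
        using A i by (intro FP.emeasure_PiM) force+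
      then show "emeasure F (\<Pi>\<^sub>E j\<in>{1..d}. A (i, j)) = (\<Prod>j=1..d. emeasure (\<mu> j) (A (i, j)))"
        by (simp only: FM[symmetric])
    qed
    also have "\<dots> = (\<Prod>p\<in>?I. emeasure (\<mu> (snd p)) (A p))"
      by (simp add: prod.cartesian_product case_prod_beta)
    finally show "emeasure (distr ?S ?P unc) (Pi\<^sub>E ?I A) = (\<Prod>p\<in>?I. emeasure (\<mu> (snd p)) (A p))" .
  qed auto
  have dS: "distr ?P ?S cur = ?S"
  proof -
    have "distr ?P ?S cur = distr (distr ?S ?P unc) ?S cur" by (simp only: dP)
    also have "\<dots> = distr ?S ?S (cur \<circ> unc)" by (rule distr_distr[OF m_cur m_unc])
    also have "\<dots> = distr ?S ?S (\<lambda>x. x)"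
    proof (rule distr_cong)
      fix x assume "x \<in> space ?S"
      then have x: "x \<in> {1..n} \<rightarrow>\<^sub>E ({1..d} \<rightarrow>\<^sub>E UNIV)"
        by (simp add: sample_law_def space_PiM continuous_lawsD(3)[OF Fc])
      show "(cur \<circ> unc) x = x"
      proof (intro ext)
        fix i j show "(cur \<circ> unc) x i j = x i j"
          using x by (cases "i \<in> {1..n}"; cases "j \<in> {1..d}")
            (auto simp: cur_def unc_def PiE_iff extensional_def simp del: atLeastAtMost_iff)
      qed
    qed auto
    finally show ?thesis by simp
  qed
  have dre: "distr ?P ?P re = ?P"
  proof -
    have "inj_on f ?I"
    proof (rule inj_onI)
      fix p q assume pq: "f p = f q"
      then have 1: "snd p = snd q" by (simp add: f_def)
      have "fst p = fst q"
      proof (cases "snd p = k")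
        case True
        then have "\<sigma> (fst p) = \<sigma> (fst q)" using pq 1 by (simp add: f_def)
        then show ?thesis by (rule injD[OF permutes_inj[OF s]])
      next
        case False
        then have "fst (f p) = fst p" "fst (f q) = fst q" using 1 by (simp_all add: f_def)
        then show ?thesis using pq by simp
      qed
      then show "p = q" using 1 by (rule prod_eqI)
    qed
    moreover have "f \<in> ?I \<rightarrow> ?I" using fI by blast
    ultimately have "distr ?P (\<Pi>\<^sub>M p\<in>?I. \<mu> (snd (f p))) re = (\<Pi>\<^sub>M p\<in>?I. \<mu> (snd (f p)))"
      unfolding re_def by (rule distr_PiM_reindex[rotated]) (rule mu)
    then show ?thesis by (simp add: f_def)
  qed
  show "permute_column n d k \<sigma> \<in> measurable ?S ?S" by (rule m_T)
  have "distr ?S ?S (permute_column n d k \<sigma>) = distr (distr ?P ?S cur) ?S (permute_column n d k \<sigma>)"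
    by (simp only: dS)
  also have "\<dots> = distr ?P ?S (permute_column n d k \<sigma> \<circ> cur)" by (rule distr_distr[OF m_T m_cur])
  also have "permute_column n d k \<sigma> \<circ> cur = cur \<circ> re"
  proof (intro ext)
    fix z i j
    have "\<sigma> i \<in> {1..n}" if "i \<in> {1..n}" using that permutes_in_image[OF s] by blast
    then show "(permute_column n d k \<sigma> \<circ> cur) z i j = (cur \<circ> re) z i j"
      by (simp add: permute_column_def cur_def re_def f_def restrict_def)
  qed
  also have "distr ?P ?S (cur \<circ> re) = distr (distr ?P ?P re) ?S cur"
    by (rule distr_distr[OF m_cur m_re, symmetric])
  also have "\<dots> = ?S" by (simp only: dre dS)
  finally show "distr ?S ?S (permute_column n d k \<sigma>) = ?S" .
qed

(* Distribution-freeness: under any null law the relative ranks of any two coordinates form a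
   uniformly distributed permutation. *)
lemma null_integral_linear_rank_stat:
  fixes \<Phi> :: "real \<Rightarrow> real"
  assumes F: "F \<in> null_laws d" and jk: "1 \<le> j" "j < k" "k \<le> d"
    and meas: "\<Phi> \<in> borel_measurable borel"
  shows "(\<integral>x. \<Phi> (linear_rank_stat c g n x j k) \<partial>sample_law n F) =
    (\<Sum>\<pi> | \<pi> permutes {1..n}. \<Phi> (\<Sum>i=1..n. c i * g (real (\<pi> i) / (real n + 1)))) / fact n"
proof -
  have Fc: "F \<in> continuous_laws d" using F by (simp add: null_laws_def)
  have d: "d \<ge> 1" and jd: "j \<in> {1..d}" "k \<in> {1..d}" using jk by auto
  let ?S = "sample_law n F" and ?V = "\<lambda>x. linear_rank_stat c g n x j k"
  let ?T = "\<lambda>\<sigma>. permute_column n d k \<sigma>" and ?perms = "{\<sigma>. \<sigma> permutes {1..n}}"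
  let ?R = "\<Sum>\<pi> | \<pi> permutes {1..n}. \<Phi> (\<Sum>i=1..n. c i * g (real (\<pi> i) / (real n + 1)))"
  interpret S: prob_space ?S by (rule prob_space_sample_law[OF Fc])
  have mV: "(\<lambda>x. \<Phi> (?V x)) \<in> borel_measurable ?S"
    by (rule measurable_compose[OF measurable_linear_rank_stat[OF Fc] meas])
  have mVT: "(\<lambda>x. \<Phi> (?V (?T \<sigma> x))) \<in> borel_measurable ?S" if "\<sigma> permutes {1..n}" for \<sigma>
    by (rule measurable_compose[OF distr_permute_column(1)[OF F d that] mV])
  have "finite (\<Phi> ` range ?V)" using finite_range_linear_rank_stat by blast
  then obtain B where B: "\<bar>\<Phi> (?V x)\<bar> \<le> B" for x
    using finite_imp_bounded[of "\<Phi> ` range ?V"] by (auto simp: bounded_iff)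
  have "(\<integral>x. \<Phi> (?V x) \<partial>?S) = (\<integral>x. \<Phi> (?V (?T \<sigma> x)) \<partial>?S)" if s: "\<sigma> permutes {1..n}" for \<sigma>
    using integral_distr[OF distr_permute_column(1)[OF F d s] mV]
    by (simp add: distr_permute_column(2)[OF F d s])
  then have "(\<Sum>\<sigma>\<in>?perms. (\<integral>x. \<Phi> (?V x) \<partial>?S)) = (\<Sum>\<sigma>\<in>?perms. (\<integral>x. \<Phi> (?V (?T \<sigma> x)) \<partial>?S))"
    by (intro sum.cong) auto
  also have "\<dots> = (\<integral>x. (\<Sum>\<sigma>\<in>?perms. \<Phi> (?V (?T \<sigma> x))) \<partial>?S)"
  proof (rule Bochner_Integration.integral_sum[symmetric])
    fix \<sigma> assume "\<sigma> \<in> ?perms"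
    then show "integrable ?S (\<lambda>x. \<Phi> (?V (?T \<sigma> x)))"
      using B mVT by (intro S.integrable_const_bound[of _ B]) auto
  qed
  also have "\<dots> = (\<integral>x. ?R \<partial>?S)"
  proof (rule integral_cong_AE)
    show "AE x in ?S. (\<Sum>\<sigma>\<in>?perms. \<Phi> (?V (?T \<sigma> x))) = ?R"
      using AE_no_ties[OF Fc jd(1)] AE_no_ties[OF Fc jd(2)]
      by eventually_elim (use sum_permute_column jd jk in blast)
  qed (use mVT in auto)
  also have "\<dots> = ?R" by (simp add: S.prob_space)
  finally have "fact n * (\<integral>x. \<Phi> (?V x) \<partial>?S) = ?R"
    using card_permutations[of "{1..n}" n] by simp
  then show ?thesis by (simp add: field_simps)
qed

lemma null_laws_nonempty:
  assumes "d \<ge> 1"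
  shows "null_laws d \<noteq> {}"
proof -
  let ?U = "uniform_measure lborel {0..1::real}"
  define F where "F = (\<Pi>\<^sub>M j\<in>{1..d}. ?U)"
  interpret U: prob_space ?U by (rule prob_space_uniform_measure) auto
  interpret F: finite_product_prob_space "\<lambda>_. ?U" "{1..d}" by standard auto
  have sets: "sets F = sets (\<Pi>\<^sub>M j\<in>{1..d}. (borel :: real measure))"
    unfolding F_def by (intro sets_PiM_cong) auto
  have cdf: "joint_cdf d F y = (\<Prod>j=1..d. max 0 (min 1 (y j)))" for y
  proof -
    have "{x \<in> space F. \<forall>j\<in>{1..d}. x j \<le> y j} = (\<Pi>\<^sub>E j\<in>{1..d}. {..y j})"
      by (rule set_eqI) (simp add: F_def space_PiM PiE_iff conj_commute del: atLeastAtMost_iff)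
    then have "joint_cdf d F y = (\<Prod>j=1..d. measure ?U {..y j})"
      using F.finite_measure_PiM_emb[of "\<lambda>j. {..y j}"] by (simp add: joint_cdf_def F_def)
    moreover have "measure ?U {..t} = max 0 (min 1 t)" for t
    proof -
      have "{0..1} \<inter> {..t} = {0..min 1 t}" by auto
      then show ?thesis by (simp add: measure_uniform_measure)
    qed
    ultimately show ?thesis by (simp only:)
  qed
  have "continuous_on UNIV (\<lambda>y::nat \<Rightarrow> real. \<Prod>j=1..d. max 0 (min 1 (y j)))"
    by (intro continuous_intros continuous_on_product_coordinates)
  then have cont: "continuous_on UNIV (joint_cdf d F)"
    by (simp add: cdf)
  have FP: "prob_space F" unfolding F_def by (rule F.prob_space_axioms)
  then have Fc: "F \<in> continuous_laws d" using sets cont by (simp add: continuous_laws_def)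
  have "distr F (\<Pi>\<^sub>M j\<in>{1..d}. borel) (\<lambda>x. \<lambda>j\<in>{1..d}. x j) = distr F F (\<lambda>x. x)"
    by (rule distr_cong) (use continuous_lawsD(2,3)[OF Fc] in \<open>auto simp: PiE_def extensional_restrict\<close>)
  also have "\<dots> = (\<Pi>\<^sub>M j\<in>{1..d}. distr F borel (\<lambda>x. x j))"
  proof -
    have "distr F borel (\<lambda>x. x j) = ?U" if "j \<in> {1..d}" for j
    proof -
      have "distr F borel (\<lambda>x. x j) = distr F ?U (\<lambda>x. x j)" by (rule distr_cong) auto
      then show ?thesis
        unfolding F_def using distr_PiM_component[of "{1..d}" "\<lambda>_. ?U" j] that U.prob_space_axioms by simp
    qed
    then have "(\<Pi>\<^sub>M j\<in>{1..d}. distr F borel (\<lambda>x. x j)) = F" unfolding F_def by (intro PiM_cong refl)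
    then show ?thesis by simp
  qed
  finally have "prob_space.indep_vars F (\<lambda>_. borel) (\<lambda>j x. x j) {1..d}"
    using assms measurable_coord[OF Fc] by (subst prob_space.indep_vars_iff_distr_eq_PiM'[OF FP]) auto
  then show ?thesis using Fc by (auto simp: null_laws_def)
qed

lemma null_mean_eq:
  assumes "F \<in> null_laws d" "1 \<le> j" "j < k" "k \<le> d"
  shows "prob_space.expectation (sample_law n F) (\<lambda>x. linear_rank_stat c g n x j k) =
    null_mean n d (linear_rank_stat c g n)"
proof -
  let ?m = "(\<Sum>\<pi> | \<pi> permutes {1..n}. \<Sum>i=1..n. c i * g (real (\<pi> i) / (real n + 1))) / fact n"
  have *: "(\<integral>x. linear_rank_stat c g n x j k \<partial>sample_law n F) = ?m"
    if "F \<in> null_laws d" "1 \<le> j" "j < k" "k \<le> d" for F j k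
    by (rule null_integral_linear_rank_stat[OF that, where \<Phi> = "\<lambda>v. v" and c = c and g = g and n = n]) simp
  have "null_mean n d (linear_rank_stat c g n) = ?m"
    unfolding null_mean_def
  proof (rule the_equality)
    show "\<forall>F\<in>null_laws d. \<forall>j k. 1 \<le> j \<and> j < k \<and> k \<le> d \<longrightarrow> prob_space.expectation (sample_law n F) (\<lambda>x. linear_rank_stat c g n x j k) = ?m"
      by (intro ballI allI impI, elim conjE, rule *)
  next
    fix m assume "\<forall>F\<in>null_laws d. \<forall>j k. 1 \<le> j \<and> j < k \<and> k \<le> d \<longrightarrow> prob_space.expectation (sample_law n F) (\<lambda>x. linear_rank_stat c g n x j k) = m"
    then have "prob_space.expectation (sample_law n F) (\<lambda>x. linear_rank_stat c g n x j k) = m" using assms by blast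
    then show "m = ?m" using *[OF assms] by (simp only:)
  qed
  then show ?thesis using *[OF assms] by (simp only:)
qed

lemma null_var_eq:
  assumes "F \<in> null_laws d" "1 \<le> j" "j < k" "k \<le> d"
  shows "prob_space.variance (sample_law n F) (\<lambda>x. linear_rank_stat c g n x j k) =
    null_var n d (linear_rank_stat c g n)"
proof -
  let ?m = "null_mean n d (linear_rank_stat c g n)"
  let ?v = "(\<Sum>\<pi> | \<pi> permutes {1..n}. ((\<Sum>i=1..n. c i * g (real (\<pi> i) / (real n + 1))) - ?m)\<^sup>2) / fact n"
  have *: "prob_space.variance (sample_law n F) (\<lambda>x. linear_rank_stat c g n x j k) = ?v"
    if "F \<in> null_laws d" "1 \<le> j" "j < k" "k \<le> d" for F j k
    unfolding null_mean_eq[OF that, where c = c and g = g and n = n]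
    by (rule null_integral_linear_rank_stat[OF that, where \<Phi> = "\<lambda>v. (v - ?m)\<^sup>2" and c = c and g = g and n = n]) simp
  have "null_var n d (linear_rank_stat c g n) = ?v"
    unfolding null_var_def
  proof (rule the_equality)
    show "\<forall>F\<in>null_laws d. \<forall>j k. 1 \<le> j \<and> j < k \<and> k \<le> d \<longrightarrow> prob_space.variance (sample_law n F) (\<lambda>x. linear_rank_stat c g n x j k) = ?v"
      by (intro ballI allI impI, elim conjE, rule *)
  next
    fix m assume "\<forall>F\<in>null_laws d. \<forall>j k. 1 \<le> j \<and> j < k \<and> k \<le> d \<longrightarrow> prob_space.variance (sample_law n F) (\<lambda>x. linear_rank_stat c g n x j k) = m"
    then have "prob_space.variance (sample_law n F) (\<lambda>x. linear_rank_stat c g n x j k) = m" using assms by blast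
    then show "m = ?v" using *[OF assms] by (simp only:)
  qed
  then show ?thesis using *[OF assms] by (simp only:)
qed

end

theory Submission
  imports Defs
begin

text \<open>
  The rejection threshold for \<open>sqrt n * L\<^sub>n / \<sigma>\<close>, with \<open>\<sigma>\<^sup>2\<close> the value of \<open>sigma2\<close>, is asymptotically
  \<open>2 * sqrt (ln d)\<close>. Under an alternative with constant 4, some pair \<open>(j, k)\<close> has
  \<open>sqrt n * \<bar>E V\<^sub>j\<^sub>k - m\<bar> / \<sigma> \<ge> 4 * sqrt (ln d)\<close>, where \<open>m\<close> is the null mean. So the test rejects as soon
  as \<open>V\<^sub>j\<^sub>k\<close> stays within \<open>\<sigma> * sqrt (ln d / n)\<close> of its own expectation: then the standardised
  deviation is at least \<open>3 * sqrt (ln d)\<close>, and \<open>9 * ln d\<close> exceeds \<open>4 * ln d - ln (ln d) + crit \<alpha>\<close>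
  eventually.
  
  The maximum over all pairs enters only through the lower bound by this one pair, and \<open>ln d\<close> tends
  to infinity, so a variance bound \<open>C\<^sup>2 / n\<close> for \<open>V\<^sub>j\<^sub>k\<close> that is uniform over all laws is enough:
  Chebyshev's inequality bounds the probability of missing the alternative by \<open>C\<^sup>2 / (\<sigma>\<^sup>2 * ln d)\<close>
  (\<open>simple_linear_rank_stat_deviation\<close>, \<open>test_power_ge\<close>).
  
  The variance bound holds whatever the dependence between the coordinates. Without ties,
  \<open>V\<^sub>j\<^sub>k\<close> is the average over the observations of a product of two rank scores. Replacing one
  observation changes every other rank by at most one, hence every other score by \<open>O(1/n)\<close>, and
  the average by at most \<open>C / n\<close> (\<open>rank_product_mean_update\<close>). A function of \<open>n\<close> independent
  variables with this property has variance at most \<open>n * (C / n)\<^sup>2\<close>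
  (\<open>variance_bounded_differences\<close>).
\<close>

section \<open>Variance under bounded differences\<close>

lemma square_le_of_abs_le: "\<bar>u\<bar> \<le> b \<Longrightarrow> u\<^sup>2 \<le> b\<^sup>2" for u b :: real
  by (metis abs_ge_zero power2_abs power_mono)

text \<open>
  The variance is the least mean squared distance from a constant, and a value \<open>X a\<close> of the
  variable itself is within \<open>c\<close> of all others.
\<close>

lemma (in prob_space) variance_le_range_squared:
  fixes X :: "'a \<Rightarrow> real"
  assumes [measurable]: "X \<in> borel_measurable M"
    and range: "\<And>x y. x \<in> space M \<Longrightarrow> y \<in> space M \<Longrightarrow> \<bar>X x - X y\<bar> \<le> c"
  shows "integrable M X" "integrable M (\<lambda>x. (X x)\<^sup>2)" "variance X \<le> c\<^sup>2"
proof -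
  obtain a where a: "a \<in> space M" using not_empty by blast
  have bound: "\<bar>X x\<bar> \<le> \<bar>X a\<bar> + c" if "x \<in> space M" for x
    using range[OF that a] by linarith
  show i1: "integrable M X"
    using bound by (intro integrable_const_bound[of _ "\<bar>X a\<bar> + c"] AE_I2) (simp_all only: real_norm_def assms(1))
  show i2: "integrable M (\<lambda>x. (X x)\<^sup>2)"
    using square_le_of_abs_le[OF bound]
    by (intro integrable_const_bound[of _ "(\<bar>X a\<bar> + c)\<^sup>2"] AE_I2) simp_all
  have dev: "(X x - X a)\<^sup>2 \<le> c\<^sup>2" if "x \<in> space M" for x
    by (rule square_le_of_abs_le[OF range[OF that a]])
  have "variance X = expectation (\<lambda>x. (X x)\<^sup>2) - (expectation X)\<^sup>2"
    by (rule variance_eq[OF i1 i2])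
  also have "\<dots> \<le> expectation (\<lambda>x. (X x)\<^sup>2) - 2 * X a * expectation X + (X a)\<^sup>2"
    using zero_le_power2[of "expectation X - X a"] by (simp add: power2_diff mult_ac)
  also have "\<dots> = expectation (\<lambda>x. (X x - X a)\<^sup>2)"
    using i1 i2 by (simp add: power2_diff prob_space mult_ac)
  also have "\<dots> \<le> expectation (\<lambda>x. c\<^sup>2)"
  proof (rule integral_mono)
    show "integrable M (\<lambda>x. (X x - X a)\<^sup>2)" using i1 i2 by (simp add: power2_diff mult_ac)
  qed (use dev in auto)
  finally show "variance X \<le> c\<^sup>2" by (simp add: prob_space)
qed

text \<open>
  A weak form of the Efron-Stein inequality, by induction on the coordinates. Averaging out the new
  coordinate \<open>i\<close> costs at most \<open>(c i)\<^sup>2\<close> by the one-variable bound, and the averaged function has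
  the same bounded differences in the remaining coordinates.
\<close>

lemma (in product_prob_space) second_moment_bounded_differences:
  fixes h :: "('i \<Rightarrow> 'a) \<Rightarrow> real"
  assumes "finite J" and "h \<in> borel_measurable (PiM J M)"
    and "\<And>x. x \<in> space (PiM J M) \<Longrightarrow> \<bar>h x\<bar> \<le> B"
    and "\<And>x i y. x \<in> space (PiM J M) \<Longrightarrow> i \<in> J \<Longrightarrow> y \<in> space (M i) \<Longrightarrow>
      \<bar>h (x(i := y)) - h x\<bar> \<le> c i"
  shows "(\<integral>x. (h x)\<^sup>2 \<partial>PiM J M) \<le> (\<integral>x. h x \<partial>PiM J M)\<^sup>2 + (\<Sum>i\<in>J. (c i)\<^sup>2)"
  using assms
proof (induction J arbitrary: h rule: finite_induct)
  case empty
  show ?case by (simp add: PiM_empty lebesgue_integral_count_space_finite)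
next
  case (insert i J h)
  let ?P = "PiM J M" and ?Q = "PiM (insert i J) M"
  interpret PJ: prob_space ?P by (rule prob_space_PiM) (rule prob_space)
  interpret Q: prob_space ?Q by (rule prob_space_PiM) (rule prob_space)
  have Mi: "prob_space (M i)" by (rule prob_space)
  have [measurable]: "h \<in> borel_measurable ?Q" by (rule insert.prems(1))
  have upd: "x(i := y) \<in> space ?Q" if "x \<in> space ?P" "y \<in> space (M i)" for x y
    using that by (auto simp: space_PiM PiE_iff extensional_def)
  have pair[measurable]: "(\<lambda>(x, y). h (x(i := y))) \<in> borel_measurable (?P \<Otimes>\<^sub>M M i)"
    using measurable_comp[OF measurable_add_dim insert.prems(1)] by (simp add: comp_def case_prod_beta')
  have sect: "(\<lambda>y. h (x(i := y))) \<in> borel_measurable (M i)" if "x \<in> space ?P" for x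
    using measurable_Pair2[OF pair that] by simp
  define H where "H = (\<lambda>x. \<integral>y. h (x(i := y)) \<partial>M i)"
  have Hm[measurable]: "H \<in> borel_measurable ?P"
    unfolding H_def by (rule M.borel_measurable_lebesgue_integral) (rule pair)
  have range: "\<bar>h (x(i := y)) - h (x(i := z))\<bar> \<le> c i"
    if "x \<in> space ?P" "y \<in> space (M i)" "z \<in> space (M i)" for x y z
    using insert.prems(3)[OF upd[OF that(1,3)], of i y] that by (simp del: fun_upd_apply)
  have int: "integrable (M i) (\<lambda>y. h (x(i := y)))" "integrable (M i) (\<lambda>y. (h (x(i := y)))\<^sup>2)"
    and var: "prob_space.variance (M i) (\<lambda>y. h (x(i := y))) \<le> (c i)\<^sup>2" if "x \<in> space ?P" for x
    using prob_space.variance_le_range_squared[OF Mi sect[OF that], of "c i"] range[OF that] by auto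
  have sq: "(\<integral>y. (h (x(i := y)))\<^sup>2 \<partial>M i) \<le> (H x)\<^sup>2 + (c i)\<^sup>2" if "x \<in> space ?P" for x
    using prob_space.variance_eq[OF Mi int[OF that]] var[OF that] by (simp add: H_def)
  have HB: "\<bar>H x\<bar> \<le> B" if x: "x \<in> space ?P" for x
  proof -
    have "\<bar>H x\<bar> \<le> (\<integral>y. \<bar>h (x(i := y))\<bar> \<partial>M i)"
      unfolding H_def by (rule integral_abs_bound)
    also have "\<dots> \<le> (\<integral>y. B \<partial>M i)"
      by (rule integral_mono) (use int(1)[OF x] insert.prems(2) upd[OF x] in auto)
    finally show ?thesis by (simp add: prob_space.prob_space[OF Mi])
  qed
  have Hdiff: "\<bar>H (x(m := y)) - H x\<bar> \<le> c m"
    if x: "x \<in> space ?P" and m: "m \<in> J" and y: "y \<in> space (M m)" for x m y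
  proof -
    have x': "x(m := y) \<in> space ?P"
      using x m y by (auto simp: space_PiM PiE_iff extensional_def)
    have "m \<noteq> i" using m insert.hyps by blast
    have "\<bar>H (x(m := y)) - H x\<bar> = \<bar>\<integral>z. h (x(m := y, i := z)) - h (x(i := z)) \<partial>M i\<bar>"
      unfolding H_def using int(1)[OF x] int(1)[OF x'] by simp
    also have "\<dots> \<le> (\<integral>z. \<bar>h (x(m := y, i := z)) - h (x(i := z))\<bar> \<partial>M i)"
      by (rule integral_abs_bound)
    also have "\<dots> \<le> (\<integral>z. c m \<partial>M i)"
    proof (rule integral_mono)
      fix z assume z: "z \<in> space (M i)"
      show "\<bar>h (x(m := y, i := z)) - h (x(i := z))\<bar> \<le> c m"
        using insert.prems(3)[OF upd[OF x z], of m y] m y fun_upd_twist[OF \<open>m \<noteq> i\<close>, of x y z]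
        by (simp del: fun_upd_apply)
    qed (use int(1)[OF x] int(1)[OF x'] in auto)
    finally show ?thesis by (simp add: prob_space.prob_space[OF Mi])
  qed
  have inth: "integrable ?Q h" "integrable ?Q (\<lambda>x. (h x)\<^sup>2)"
    using insert.prems(2) square_le_of_abs_le[OF insert.prems(2)]
    by (intro Q.integrable_const_bound[of _ B] Q.integrable_const_bound[of _ "B\<^sup>2"] AE_I2; simp)+
  have intH: "integrable ?P (\<lambda>x. (H x)\<^sup>2)"
    using square_le_of_abs_le[OF HB] by (intro PJ.integrable_const_bound[of _ "B\<^sup>2"] AE_I2) simp_all
  have "(\<integral>x. (h x)\<^sup>2 \<partial>?Q) = (\<integral>x. (\<integral>y. (h (x(i := y)))\<^sup>2 \<partial>M i) \<partial>?P)"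
    by (rule product_integral_insert) (use insert.hyps inth in auto)
  also have "\<dots> \<le> (\<integral>x. (H x)\<^sup>2 + (c i)\<^sup>2 \<partial>?P)"
    by (rule integral_mono') (use sq intH in auto)
  also have "\<dots> = (\<integral>x. (H x)\<^sup>2 \<partial>?P) + (c i)\<^sup>2"
    using intH by (simp add: PJ.prob_space)
  also have "\<dots> \<le> (\<integral>x. H x \<partial>?P)\<^sup>2 + (\<Sum>i\<in>J. (c i)\<^sup>2) + (c i)\<^sup>2"
    using insert.IH[OF Hm HB Hdiff] by simp
  also have "(\<integral>x. H x \<partial>?P) = (\<integral>x. h x \<partial>?Q)"
    unfolding H_def by (rule product_integral_insert[symmetric]) (use insert.hyps inth in auto)
  finally show ?case using insert.hyps by simp
qed

corollary (in product_prob_space) variance_bounded_differences: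
  fixes h :: "('i \<Rightarrow> 'a) \<Rightarrow> real"
  assumes J: "finite J" and h: "h \<in> borel_measurable (PiM J M)"
    and B: "\<And>x. x \<in> space (PiM J M) \<Longrightarrow> \<bar>h x\<bar> \<le> B"
    and c: "\<And>x i y. x \<in> space (PiM J M) \<Longrightarrow> i \<in> J \<Longrightarrow> y \<in> space (M i) \<Longrightarrow>
      \<bar>h (x(i := y)) - h x\<bar> \<le> c i"
  shows "prob_space.variance (PiM J M) h \<le> (\<Sum>i\<in>J. (c i)\<^sup>2)"
proof -
  interpret PJ: prob_space "PiM J M" by (rule prob_space_PiM) (rule prob_space)
  have "(h x)\<^sup>2 \<le> B\<^sup>2" if "x \<in> space (PiM J M)" for x
    by (rule square_le_of_abs_le[OF B[OF that]])
  then have "integrable (PiM J M) h" "integrable (PiM J M) (\<lambda>x. (h x)\<^sup>2)"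
    using B h by (intro PJ.integrable_const_bound[of _ B] PJ.integrable_const_bound[of _ "B\<^sup>2"] AE_I2; simp)+
  then show ?thesis
    using second_moment_bounded_differences[OF J h B c] by (simp add: PJ.variance_eq)
qed

section \<open>Rank statistics as functions of independent observations\<close>

definition rank_score :: "(real \<Rightarrow> real) \<Rightarrow> nat \<Rightarrow> sample \<Rightarrow> nat \<Rightarrow> nat \<Rightarrow> real" where
  "rank_score f n x j i = f (real (obs_rank n x j i) / (real n + 1))"

text \<open>
  Relative ranks are ordered by the ranks of one coordinate, which hides the contribution of a single
  observation. Summing over the observations instead exposes it. This version is also defined by
  the same formula for samples with ties, so that its differences are bounded at every sample and not
  only almost surely.
\<close>

definition rank_product_mean :: "(real \<Rightarrow> real) \<Rightarrow> (real \<Rightarrow> real) \<Rightarrow> nat \<Rightarrow> pair_stat" where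
  "rank_product_mean f g n x j k = (\<Sum>i=1..n. rank_score f n x j i * rank_score g n x k i) / real n"

text \<open>
  Without ties the ranks in coordinate \<open>j\<close> form a permutation, along which the sum over ranks is
  reindexed by observations.
\<close>

lemma simple_linear_rank_stat_eq_rank_product_mean:
  assumes "no_ties n j x"
  shows "simple_linear_rank_stat f g n x j k = rank_product_mean f g n x j k"
proof -
  let ?p = "rank_perm n x j" and ?q = "rank_perm n x k"
  note p = rank_perm_permutes[OF assms]
  let ?t = "\<lambda>a b. f (real a / (real n + 1)) / real n * g (real b / (real n + 1))"
  have "simple_linear_rank_stat f g n x j k = (\<Sum>i=1..n. ?t i (?q (inv ?p i)))"
    unfolding simple_linear_rank_stat_def linear_rank_stat_def
    by (intro sum.cong refl) (simp only: relative_rank_eq[OF assms])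
  also have "\<dots> = (\<Sum>i=1..n. ?t (?p i) (?q i))"
    by (subst sum.permute[OF p]) (simp add: o_def permutes_inverses(2)[OF p])
  also have "\<dots> = rank_product_mean f g n x j k"
    unfolding rank_product_mean_def sum_divide_distrib
    by (intro sum.cong refl) (simp add: rank_perm_def rank_score_def)
  finally show ?thesis .
qed

text \<open>
  A rank counts the observations at or below a given one; only the replaced observation can enter or leave
  this count.
\<close>

lemma obs_rank_update:
  assumes "i \<noteq> m"
  shows "\<bar>real (obs_rank n (x(m := y)) j i) - real (obs_rank n x j i)\<bar> \<le> 1"
proof -
  have le: "card {l \<in> {1..n}. z l j \<le> z i j} \<le> card {l \<in> {1..n}. w l j \<le> w i j} + 1"
    if "\<And>l. l \<noteq> m \<Longrightarrow> z l = w l" for z w :: sample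
  proof -
    have "{l \<in> {1..n}. z l j \<le> z i j} \<subseteq> insert m {l \<in> {1..n}. w l j \<le> w i j}"
      using that assms by auto
    then have "card {l \<in> {1..n}. z l j \<le> z i j} \<le> card (insert m {l \<in> {1..n}. w l j \<le> w i j})"
      by (intro card_mono) auto
    also have "\<dots> \<le> card {l \<in> {1..n}. w l j \<le> w i j} + 1"
      by (simp add: card_insert_if)
    finally show ?thesis .
  qed
  show ?thesis
    using le[of "x(m := y)" x] le[of x "x(m := y)"] unfolding obs_rank_def by simp
qed

lemma rank_in_unit_interval: "real (obs_rank n x j i) / (real n + 1) \<in> {0..1}"
  using obs_rank_le[of n x j i] by simp

lemma rank_score_bound:
  assumes "L-lipschitz_on {0..1} f" "\<bar>f 0\<bar> \<le> A"
  shows "\<bar>rank_score f n x j i\<bar> \<le> A + L"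
proof -
  let ?u = "real (obs_rank n x j i) / (real n + 1)"
  have u: "?u \<in> {0..1}" by (rule rank_in_unit_interval)
  have "\<bar>f ?u - f 0\<bar> \<le> L * \<bar>?u - 0\<bar>"
    using lipschitz_onD[OF assms(1) u, of 0] by (simp add: dist_real_def)
  also have "\<dots> \<le> L"
    by (rule mult_left_le[OF _ lipschitz_on_nonneg[OF assms(1)]]) (use u in simp)
  finally show ?thesis using assms(2) by (simp add: rank_score_def)
qed

lemma rank_score_update:
  assumes "L-lipschitz_on {0..1} f" "i \<noteq> m"
  shows "\<bar>rank_score f n (x(m := y)) j i - rank_score f n x j i\<bar> \<le> L / (real n + 1)"
proof -
  let ?r = "real (obs_rank n (x(m := y)) j i)" and ?s = "real (obs_rank n x j i)"
  have "\<bar>rank_score f n (x(m := y)) j i - rank_score f n x j i\<bar>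
      \<le> L * \<bar>?r / (real n + 1) - ?s / (real n + 1)\<bar>"
    using lipschitz_onD[OF assms(1) rank_in_unit_interval rank_in_unit_interval]
    by (simp add: dist_real_def rank_score_def)
  also have "\<dots> = L * (\<bar>?r - ?s\<bar> / (real n + 1))"
    by (simp add: diff_divide_distrib[symmetric])
  also have "\<dots> \<le> L * (1 / (real n + 1))"
    using obs_rank_update[OF assms(2)] lipschitz_on_nonneg[OF assms(1)]
    by (intro mult_left_mono divide_right_mono) auto
  finally show ?thesis by simp
qed

text \<open>
  The first two summands of \<open>C\<close> collect the \<open>n\<close> changes of order \<open>1/n\<close> in the products of the other
  observations, by the Lipschitz property of one factor and the bound on the other. The
  last summand is the largest change in the product of observation \<open>m\<close> itself.
\<close>

lemma rank_product_mean_update: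
  assumes f: "L\<^sub>f-lipschitz_on {0..1} f" "\<bar>f 0\<bar> \<le> A" and g: "L\<^sub>g-lipschitz_on {0..1} g" "\<bar>g 0\<bar> \<le> A"
  defines "C \<equiv> L\<^sub>f * (A + L\<^sub>g) + (A + L\<^sub>f) * L\<^sub>g + 2 * (A + L\<^sub>f) * (A + L\<^sub>g)"
  shows "\<bar>rank_product_mean f g n (x(m := y)) j k - rank_product_mean f g n x j k\<bar> \<le> C / real n"
proof (cases "n = 0")
  case False
  let ?K = "L\<^sub>f * (A + L\<^sub>g) + (A + L\<^sub>f) * L\<^sub>g" and ?D = "2 * (A + L\<^sub>f) * (A + L\<^sub>g)"
  let ?a = "rank_score f n (x(m := y)) j" and ?b = "rank_score g n (x(m := y)) k"
  let ?a' = "rank_score f n x j" and ?b' = "rank_score g n x k"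
  note bf = rank_score_bound[OF f] and bg = rank_score_bound[OF g]
  have nonneg: "L\<^sub>f \<ge> 0" "L\<^sub>g \<ge> 0" "A \<ge> 0"
    using lipschitz_on_nonneg[OF f(1)] lipschitz_on_nonneg[OF g(1)] f(2) by auto
  have t: "\<bar>?a i * ?b i - ?a' i * ?b' i\<bar> \<le> ?K / (real n + 1) + (if i = m then ?D else 0)" for i
  proof (cases "i = m")
    case True
    have "\<bar>?a i * ?b i - ?a' i * ?b' i\<bar> \<le> \<bar>?a i\<bar> * \<bar>?b i\<bar> + \<bar>?a' i\<bar> * \<bar>?b' i\<bar>"
      by (simp flip: abs_mult)
    also have "\<dots> \<le> (A + L\<^sub>f) * (A + L\<^sub>g) + (A + L\<^sub>f) * (A + L\<^sub>g)"
      using nonneg by (intro add_mono mult_mono bf bg) auto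
    also have "\<dots> \<le> ?K / (real n + 1) + ?D"
    proof -
      have "?K / (real n + 1) \<ge> 0" using nonneg by simp
      then show ?thesis by linarith
    qed
    finally show ?thesis using True by simp
  next
    case i: False
    have "?a i * ?b i - ?a' i * ?b' i = (?a i - ?a' i) * ?b i + ?a' i * (?b i - ?b' i)"
      by (simp add: algebra_simps)
    then have "\<bar>?a i * ?b i - ?a' i * ?b' i\<bar> \<le> \<bar>?a i - ?a' i\<bar> * \<bar>?b i\<bar> + \<bar>?a' i\<bar> * \<bar>?b i - ?b' i\<bar>"
      by (metis abs_mult abs_triangle_ineq)
    also have "\<dots> \<le> L\<^sub>f / (real n + 1) * (A + L\<^sub>g) + (A + L\<^sub>f) * (L\<^sub>g / (real n + 1))"
      using nonneg by (intro add_mono mult_mono bf bg rank_score_update f(1) g(1) i) auto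
    also have "\<dots> = ?K / (real n + 1)" by (simp add: add_divide_distrib)
    finally show ?thesis using i by simp
  qed
  have "\<bar>(\<Sum>i=1..n. ?a i * ?b i) - (\<Sum>i=1..n. ?a' i * ?b' i)\<bar>
      \<le> (\<Sum>i=1..n. \<bar>?a i * ?b i - ?a' i * ?b' i\<bar>)"
    unfolding sum_subtractf[symmetric] by (rule sum_abs)
  also have "\<dots> \<le> (\<Sum>i=1..n. ?K / (real n + 1) + (if i = m then ?D else 0))"
    by (intro sum_mono t)
  also have "\<dots> \<le> real n * (?K / (real n + 1)) + ?D"
    using nonneg by (simp add: sum.distrib)
  also have "real n * (?K / (real n + 1)) = real n / (real n + 1) * ?K" by simp
  also have "\<dots> \<le> 1 * ?K" using nonneg by (intro mult_right_mono) auto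
  finally have "\<bar>(\<Sum>i=1..n. ?a i * ?b i) - (\<Sum>i=1..n. ?a' i * ?b' i)\<bar> \<le> C"
    by (simp add: C_def del: fun_upd_apply)
  then show ?thesis
    by (simp add: rank_product_mean_def diff_divide_distrib[symmetric] divide_right_mono del: fun_upd_apply)
qed (simp add: rank_product_mean_def)

lemma rank_product_mean_bound:
  assumes f: "L\<^sub>f-lipschitz_on {0..1} f" "\<bar>f 0\<bar> \<le> A" and g: "L\<^sub>g-lipschitz_on {0..1} g" "\<bar>g 0\<bar> \<le> A"
  shows "\<bar>rank_product_mean f g n x j k\<bar> \<le> (A + L\<^sub>f) * (A + L\<^sub>g)"
proof (cases "n = 0")
  case True
  have "L\<^sub>f \<ge> 0" "L\<^sub>g \<ge> 0" "A \<ge> 0"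
    using lipschitz_on_nonneg[OF f(1)] lipschitz_on_nonneg[OF g(1)] f(2) by auto
  then show ?thesis using True by (simp add: rank_product_mean_def)
next
  case False
  have "\<bar>\<Sum>i=1..n. rank_score f n x j i * rank_score g n x k i\<bar>
      \<le> (\<Sum>i=1..n. \<bar>rank_score f n x j i * rank_score g n x k i\<bar>)" by (rule sum_abs)
  also have "\<dots> \<le> (\<Sum>i=1..n. (A + L\<^sub>f) * (A + L\<^sub>g))"
  proof (rule sum_mono)
    fix i
    have "\<bar>rank_score f n x j i\<bar> * \<bar>rank_score g n x k i\<bar> \<le> (A + L\<^sub>f) * (A + L\<^sub>g)"
      using rank_score_bound[OF f, of n x j i] rank_score_bound[OF g, of n x k i]
      by (intro mult_mono) linarith+
    then show "\<bar>rank_score f n x j i * rank_score g n x k i\<bar> \<le> (A + L\<^sub>f) * (A + L\<^sub>g)"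
      by (simp add: abs_mult)
  qed
  finally show ?thesis
    using False by (simp add: rank_product_mean_def field_simps)
qed

lemma measurable_rank_product_mean:
  assumes "F \<in> continuous_laws d"
  shows "(\<lambda>x. rank_product_mean f g n x j k) \<in> borel_measurable (sample_law n F)"
proof -
  have [measurable]: "(\<lambda>x. rank_score f n x j i) \<in> borel_measurable (sample_law n F)" for f j i
    unfolding rank_score_def by (rule measurable_compose[OF measurable_obs_rank[OF assms]]) simp
  show ?thesis unfolding rank_product_mean_def by measurable
qed

lemma variance_rank_product_mean:
  assumes F: "F \<in> continuous_laws d"
    and f: "L\<^sub>f-lipschitz_on {0..1} f" "\<bar>f 0\<bar> \<le> A" and g: "L\<^sub>g-lipschitz_on {0..1} g" "\<bar>g 0\<bar> \<le> A"
  defines "C \<equiv> L\<^sub>f * (A + L\<^sub>g) + (A + L\<^sub>f) * L\<^sub>g + 2 * (A + L\<^sub>f) * (A + L\<^sub>g)"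
  shows "prob_space.variance (sample_law n F) (\<lambda>x. rank_product_mean f g n x j k) \<le> C\<^sup>2 / real n"
proof -
  interpret F: prob_space F by (rule continuous_lawsD(1)[OF F])
  interpret P: product_prob_space "\<lambda>_::nat. F" by standard
  have "prob_space.variance (sample_law n F) (\<lambda>x. rank_product_mean f g n x j k)
      \<le> (\<Sum>i\<in>{1..n}. (C / real n)\<^sup>2)"
    unfolding sample_law_def
  proof (rule P.variance_bounded_differences)
    show "(\<lambda>x. rank_product_mean f g n x j k) \<in> borel_measurable (\<Pi>\<^sub>M i\<in>{1..n}. F)"
      using measurable_rank_product_mean[OF F] by (simp add: sample_law_def)
    show "\<bar>rank_product_mean f g n x j k\<bar> \<le> (A + L\<^sub>f) * (A + L\<^sub>g)" for x
      by (rule rank_product_mean_bound[OF f g])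
    show "\<bar>rank_product_mean f g n (x(m := y)) j k - rank_product_mean f g n x j k\<bar> \<le> C / real n" for x m y
      unfolding C_def by (rule rank_product_mean_update[OF f g])
  qed simp
  also have "\<dots> = C\<^sup>2 / real n"
    by (simp add: power2_eq_square)
  finally show ?thesis .
qed

text \<open>
  Chebyshev's inequality. The statistic is replaced by \<open>rank_product_mean\<close>, with which it agrees
  outside the null set of samples with ties in coordinate \<open>j\<close>.
\<close>

lemma simple_linear_rank_stat_deviation:
  fixes n j k :: nat and f g :: "real \<Rightarrow> real"
  assumes F: "F \<in> continuous_laws d" and j: "j \<in> {1..d}"
    and f: "L\<^sub>f-lipschitz_on {0..1} f" "\<bar>f 0\<bar> \<le> A" and g: "L\<^sub>g-lipschitz_on {0..1} g" "\<bar>g 0\<bar> \<le> A"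
    and t: "t > 0"
  defines "C \<equiv> L\<^sub>f * (A + L\<^sub>g) + (A + L\<^sub>f) * L\<^sub>g + 2 * (A + L\<^sub>f) * (A + L\<^sub>g)"
    and "S \<equiv> sample_law n F" and "V \<equiv> \<lambda>x. simple_linear_rank_stat f g n x j k"
  shows "measure S {x \<in> space S. \<bar>V x - prob_space.expectation S V\<bar> \<ge> t} \<le> C\<^sup>2 / (real n * t\<^sup>2)"
proof -
  interpret S: prob_space S unfolding S_def by (rule prob_space_sample_law[OF F])
  let ?H = "\<lambda>x. rank_product_mean f g n x j k"
  have Hm[measurable]: "?H \<in> borel_measurable S"
    unfolding S_def by (rule measurable_rank_product_mean[OF F])
  have Vm[measurable]: "V \<in> borel_measurable S"
    unfolding S_def V_def simple_linear_rank_stat_def by (rule measurable_linear_rank_stat[OF F])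
  have ae: "AE x in S. V x = ?H x"
    using AE_no_ties[OF F j, of n] unfolding S_def V_def
    by eventually_elim (rule simple_linear_rank_stat_eq_rank_product_mean)
  have E: "S.expectation V = S.expectation ?H"
    by (rule integral_cong_AE) (use ae in auto)
  have B: "\<bar>?H x\<bar> \<le> (A + L\<^sub>f) * (A + L\<^sub>g)" for x
    by (rule rank_product_mean_bound[OF f g])
  have B2: "(?H x)\<^sup>2 \<le> ((A + L\<^sub>f) * (A + L\<^sub>g))\<^sup>2" for x
    by (rule square_le_of_abs_le[OF B])
  have int: "integrable S (\<lambda>x. (?H x)\<^sup>2)"
    using B2 by (intro S.integrable_const_bound[of _ "((A + L\<^sub>f) * (A + L\<^sub>g))\<^sup>2"]) auto
  have "measure S {x \<in> space S. \<bar>V x - S.expectation V\<bar> \<ge> t} = measure S {x \<in> space S. \<bar>?H x - S.expectation ?H\<bar> \<ge> t}"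
    unfolding E by (rule measure_eq_AE) (use ae in auto)
  also have "\<dots> \<le> S.variance ?H / t\<^sup>2"
    by (rule S.Chebyshev_inequality[OF Hm int t])
  also have "\<dots> \<le> C\<^sup>2 / real n / t\<^sup>2"
    unfolding S_def C_def by (intro divide_right_mono variance_rank_product_mean[OF F f g]) simp
  finally show ?thesis by simp
qed

section \<open>Power of the test\<close>

lemma finite_coordinate_pairs: "finite {(j, k). 1 \<le> j \<and> j < k \<and> k \<le> (d::nat)}"
  by (rule finite_subset[of _ "{1..d} \<times> {1..d}"]) auto

lemma Max_over_pairs:
  fixes u :: "nat \<Rightarrow> nat \<Rightarrow> real"
  shows "Max {u j k | j k. 1 \<le> j \<and> j < k \<and> k \<le> d} =
    Max ((\<lambda>p. u (fst p) (snd p)) ` {(j, k). 1 \<le> j \<and> j < k \<and> k \<le> d})"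
  by (rule arg_cong[where f = Max]) force

lemma max_dev_ge:
  assumes "1 \<le> j" "j < k" "k \<le> d"
  shows "\<bar>V x j k - null_mean n d V\<bar> \<le> max_dev n d V x"
  unfolding max_dev_def Max_over_pairs
  by (rule Max_ge) (use assms finite_coordinate_pairs in \<open>auto intro!: image_eqI[of _ _ "(j, k)"]\<close>)

lemma sparse_alternatives_witness:
  assumes "M \<in> sparse_alternatives c n d" "d \<ge> 2"
  obtains j k where "1 \<le> j" "j < k" "k \<le> d" "\<bar>M j k\<bar> \<ge> c * sqrt (ln (real d) / real n)"
proof -
  let ?P = "{(j, k). 1 \<le> j \<and> j < k \<and> k \<le> d}"
  have "(1, 2) \<in> ?P" using assms(2) by simp
  then have "Max ((\<lambda>p. \<bar>M (fst p) (snd p)\<bar>) ` ?P) \<in> (\<lambda>p. \<bar>M (fst p) (snd p)\<bar>) ` ?P"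
    using finite_coordinate_pairs by (intro Max_in) blast+
  then obtain j k where "(j, k) \<in> ?P" "Max ((\<lambda>p. \<bar>M (fst p) (snd p)\<bar>) ` ?P) = \<bar>M j k\<bar>"
    by auto
  moreover have "Max ((\<lambda>p. \<bar>M (fst p) (snd p)\<bar>) ` ?P) \<ge> c * sqrt (ln (real d) / real n)"
    using assms(1)
    unfolding sparse_alternatives_def mem_Collect_eq Max_over_pairs[of "\<lambda>j k. \<bar>M j k\<bar>"] by blast
  ultimately show ?thesis by (intro that[of j k]) simp_all
qed

lemma measurable_rank_test:
  assumes "F \<in> continuous_laws d"
  shows "{x \<in> space (sample_law n F). rank_test \<alpha> n d (simple_linear_rank_stat f g n) x = 1}
    \<in> sets (sample_law n F)"
proof -
  have [measurable]: "(\<lambda>x. simple_linear_rank_stat f g n x j k) \<in> borel_measurable (sample_law n F)" for j k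
    unfolding simple_linear_rank_stat_def by (rule measurable_linear_rank_stat[OF assms])
  have [measurable]: "(\<lambda>x. max_dev n d (simple_linear_rank_stat f g n) x) \<in> borel_measurable (sample_law n F)"
    unfolding max_dev_def Max_over_pairs
    by (rule borel_measurable_Max[OF finite_coordinate_pairs]) measurable
  show ?thesis unfolding rank_test_def by simp
qed

text \<open>
  The mean is at distance \<open>4\<close> from the null mean and the statistic at distance less than \<open>1\<close> from its
  mean, in units of \<open>\<sigma> * sqrt (ln d / n)\<close>. The hypothesis on \<open>crit \<alpha>\<close> is the surplus \<open>(4 - 1)\<^sup>2 - 4 = 5\<close>
  in units of \<open>ln d\<close>.
\<close>

lemma rank_test_rejects:
  fixes \<sigma> :: real
  assumes jk: "1 \<le> j" "j < k" "k \<le> d" and n: "n > 0"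
    and s: "\<sigma> > 0" "\<sigma>\<^sup>2 = sigma2 n d V"
    and mean: "\<bar>e - null_mean n d V\<bar> \<ge> 4 * \<sigma> * sqrt (ln (real d) / real n)"
    and dev: "\<bar>V x j k - e\<bar> < \<sigma> * sqrt (ln (real d) / real n)"
    and large: "crit \<alpha> \<le> 5 * ln (real d) + ln (ln (real d))"
  shows "rank_test \<alpha> n d V x = 1"
proof -
  let ?l = "ln (real d)"
  let ?r = "sqrt (?l / real n)"
  have l: "?l \<ge> 0" using jk by simp
  have "3 * \<sigma> * ?r \<le> \<bar>V x j k - null_mean n d V\<bar>" using mean dev by linarith
  also have "\<dots> \<le> max_dev n d V x" by (rule max_dev_ge[OF jk])
  finally have "(3 * \<sigma> * ?r)\<^sup>2 \<le> (max_dev n d V x)\<^sup>2"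
    using s(1) l by (intro power_mono) auto
  moreover have "(3 * \<sigma> * ?r)\<^sup>2 = 9 * \<sigma>\<^sup>2 * (?l / real n)"
    using l by (simp add: power_mult_distrib)
  ultimately have "9 * \<sigma>\<^sup>2 * (?l / real n) \<le> (max_dev n d V x)\<^sup>2" by simp
  then have "9 * ?l \<le> real n * (max_dev n d V x)\<^sup>2 / \<sigma>\<^sup>2"
    using n s(1) by (simp add: field_simps)
  then show ?thesis
    using large s(2) by (simp add: rank_test_def)
qed

text \<open>
  The pair \<open>(j, k)\<close> that witnesses the alternative depends on the law, but the bound does not; this
  uniformity is what makes it a bound on the worst power.
\<close>

lemma test_power_ge:
  assumes F: "F \<in> alternative_laws 4 n d (simple_linear_rank_stat f g n)"
    and f: "L\<^sub>f-lipschitz_on {0..1} f" "\<bar>f 0\<bar> \<le> A" and g: "L\<^sub>g-lipschitz_on {0..1} g" "\<bar>g 0\<bar> \<le> A"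
    and n: "n > 0" and d: "d \<ge> 2" and s: "sigma2 n d (simple_linear_rank_stat f g n) > 0"
    and large: "crit \<alpha> \<le> 5 * ln (real d) + ln (ln (real d))"
  defines "C \<equiv> L\<^sub>f * (A + L\<^sub>g) + (A + L\<^sub>f) * L\<^sub>g + 2 * (A + L\<^sub>f) * (A + L\<^sub>g)"
  shows "test_power \<alpha> n d (simple_linear_rank_stat f g n) F \<ge>
    1 - C\<^sup>2 / (sigma2 n d (simple_linear_rank_stat f g n) * ln (real d))"
proof -
  let ?V = "simple_linear_rank_stat f g n" and ?S = "sample_law n F"
  have Fc: "F \<in> continuous_laws d" and alt: "V_matrix n d ?V F \<in> sparse_alternatives 4 n d"
    using F by (auto simp: alternative_laws_def)
  interpret S: prob_space ?S by (rule prob_space_sample_law[OF Fc])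
  obtain j k where jk: "1 \<le> j" "j < k" "k \<le> d"
    and big: "\<bar>V_matrix n d ?V F j k\<bar> \<ge> 4 * sqrt (ln (real d) / real n)"
    using sparse_alternatives_witness[OF alt d] .
  define \<sigma> where "\<sigma> = sqrt (sigma2 n d ?V)"
  have \<sigma>: "\<sigma> > 0" "\<sigma>\<^sup>2 = sigma2 n d ?V" using s by (auto simp: \<sigma>_def)
  define e where "e = S.expectation (\<lambda>x. ?V x j k)"
  \<comment> \<open>the excess of the alternative's 4 over the 3 that suffices for rejection\<close>
  define t where "t = \<sigma> * sqrt (ln (real d) / real n)"
  have l: "ln (real d) > 0" using d by simp
  then have t: "t > 0" "real n * t\<^sup>2 = sigma2 n d ?V * ln (real d)"
    using n \<sigma> by (auto simp: t_def power_mult_distrib)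
  have Vm[measurable]: "(\<lambda>x. ?V x j k) \<in> borel_measurable ?S"
    unfolding simple_linear_rank_stat_def by (rule measurable_linear_rank_stat[OF Fc])
  have "finite (range (\<lambda>x. ?V x j k))"
    unfolding simple_linear_rank_stat_def by (rule finite_range_linear_rank_stat)
  then obtain B where B: "\<bar>?V x j k\<bar> \<le> B" for x
    using finite_imp_bounded[of "range (\<lambda>x. ?V x j k)"] by (auto simp: bounded_iff)
  have int: "integrable ?S (\<lambda>x. ?V x j k)"
    using B by (intro S.integrable_const_bound[of _ B]) auto
  have "V_matrix n d ?V F j k = S.expectation (\<lambda>x. inverse \<sigma> * (?V x j k - null_mean n d ?V))"
    using jk by (simp add: V_matrix_def V_hat_def \<sigma>_def)
  also have "\<dots> = (e - null_mean n d ?V) / \<sigma>"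
    using int by (simp add: e_def S.prob_space field_simps)
  finally have mean: "\<bar>e - null_mean n d ?V\<bar> \<ge> 4 * \<sigma> * sqrt (ln (real d) / real n)"
    using big \<sigma>(1) by (simp add: abs_divide pos_le_divide_eq mult_ac)
  have reject: "rank_test \<alpha> n d ?V x = 1" if "\<bar>?V x j k - e\<bar> < t" for x
    by (rule rank_test_rejects[OF jk n \<sigma> mean _ large]) (use that in \<open>simp add: t_def\<close>)
  have "j \<in> {1..d}" using jk by simp
  then have "measure ?S {x \<in> space ?S. \<bar>?V x j k - e\<bar> \<ge> t} \<le> C\<^sup>2 / (real n * t\<^sup>2)"
    unfolding e_def C_def by (rule simple_linear_rank_stat_deviation[OF Fc _ f g t(1)])
  then have "1 - C\<^sup>2 / (sigma2 n d ?V * ln (real d)) \<le> 1 - measure ?S {x \<in> space ?S. \<bar>?V x j k - e\<bar> \<ge> t}"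
    by (simp add: t(2))
  also have "\<dots> = measure ?S {x \<in> space ?S. \<bar>?V x j k - e\<bar> < t}"
    by (subst S.prob_neg[symmetric]) (auto simp: not_le)
  also have "\<dots> \<le> test_power \<alpha> n d ?V F"
    unfolding test_power_def
    by (rule S.finite_measure_mono) (use reject measurable_rank_test[OF Fc] in auto)
  finally show ?thesis .
qed

lemma worst_power_bounds:
  assumes "\<And>F. F \<in> alternative_laws c n d V \<Longrightarrow> test_power \<alpha> n d V F \<ge> p" and "p \<le> 1"
  shows "p \<le> worst_power \<alpha> c n d V" "worst_power \<alpha> c n d V \<le> 1"
proof -
  show "p \<le> worst_power \<alpha> c n d V"
    unfolding worst_power_def by (rule cInf_greatest) (use assms in auto)
  show "worst_power \<alpha> c n d V \<le> 1"
    unfolding worst_power_def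
    by (rule cInf_lower) (use assms in \<open>auto intro!: bdd_belowI[of _ p]\<close>)
qed

theorem theorem3:
  fixes A\<^sub>1 A\<^sub>2 L\<^sub>f L\<^sub>g :: real
  assumes "A\<^sub>1 > 0" and "A\<^sub>2 > 0"
  shows "\<exists>B\<^sub>1>0. \<forall>(\<alpha>::real) (f::real \<Rightarrow> real) (g::real \<Rightarrow> real) (d::nat \<Rightarrow> nat).
    0 < \<alpha> \<and> \<alpha> < 1 \<and>
    filterlim d at_top sequentially \<and>
    L\<^sub>f-lipschitz_on {0..1} f \<and> L\<^sub>g-lipschitz_on {0..1} g \<and>
    max \<bar>f 0\<bar> \<bar>g 0\<bar> \<le> A\<^sub>2 \<and>
    (\<lambda>n. sigma2 n (d n) (simple_linear_rank_stat f g n)) \<sim>[sequentially] (\<lambda>_. A\<^sub>1)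
    \<longrightarrow> (\<lambda>n. worst_power \<alpha> B\<^sub>1 n (d n) (simple_linear_rank_stat f g n)) \<longlonglongrightarrow> 1"
proof (intro exI[of _ 4] conjI allI impI)
  fix \<alpha> :: real and f g :: "real \<Rightarrow> real" and d :: "nat \<Rightarrow> nat"
  let ?V = "simple_linear_rank_stat f g"
  let ?s = "\<lambda>n. sigma2 n (d n) (?V n)" and ?l = "\<lambda>n. ln (real (d n))"
  assume "0 < \<alpha> \<and> \<alpha> < 1 \<and>
    filterlim d at_top sequentially \<and>
    L\<^sub>f-lipschitz_on {0..1} f \<and> L\<^sub>g-lipschitz_on {0..1} g \<and>
    max \<bar>f 0\<bar> \<bar>g 0\<bar> \<le> A\<^sub>2 \<and> ?s \<sim>[sequentially] (\<lambda>_. A\<^sub>1)"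
  then have d: "filterlim d at_top sequentially"
    and f: "L\<^sub>f-lipschitz_on {0..1} f" "\<bar>f 0\<bar> \<le> A\<^sub>2" and g: "L\<^sub>g-lipschitz_on {0..1} g" "\<bar>g 0\<bar> \<le> A\<^sub>2"
    and s: "?s \<sim>[sequentially] (\<lambda>_. A\<^sub>1)" by auto
  have s_lim: "?s \<longlonglongrightarrow> A\<^sub>1"
    using asymp_equiv_tendsto_transfer[OF asymp_equiv_symI[OF s] tendsto_const] .
  have l_lim: "filterlim ?l at_top sequentially"
    by (intro filterlim_compose[OF ln_at_top] filterlim_compose[OF filterlim_real_sequentially] d)
  have crit: "filterlim (\<lambda>n. 5 * ?l n + ln (?l n)) at_top sequentially"
    by (intro filterlim_at_top_add_at_top filterlim_tendsto_pos_mult_at_top[OF tendsto_const]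
        filterlim_compose[OF ln_at_top] l_lim) simp
  define C where "C = L\<^sub>f * (A\<^sub>2 + L\<^sub>g) + (A\<^sub>2 + L\<^sub>f) * L\<^sub>g + 2 * (A\<^sub>2 + L\<^sub>f) * (A\<^sub>2 + L\<^sub>g)"
  let ?p = "\<lambda>n. 1 - C\<^sup>2 / (?s n * ?l n)"
  have bounds: "\<forall>\<^sub>F n in sequentially. ?p n \<le> worst_power \<alpha> 4 n (d n) (?V n) \<and> worst_power \<alpha> 4 n (d n) (?V n) \<le> 1"
    using order_tendstoD(1)[OF s_lim assms(1)] eventually_gt_at_top[of 0]
      filterlim_at_top[THEN iffD1, OF d, rule_format, of 2]
      filterlim_at_top[THEN iffD1, OF crit, rule_format, of "crit \<alpha>"]
  proof eventually_elim
    case (elim n)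
    have power: "?p n \<le> test_power \<alpha> n (d n) (?V n) F" if "F \<in> alternative_laws 4 n (d n) (?V n)" for F
      unfolding C_def by (rule test_power_ge[OF that f g]) (use elim in auto)
    have "?p n \<le> 1" using elim by simp
    then show ?case using worst_power_bounds[OF power] by blast
  qed
  have p_lim: "?p \<longlonglongrightarrow> 1"
  proof -
    have "filterlim (\<lambda>n. ?s n * ?l n) at_top sequentially"
      by (rule filterlim_tendsto_pos_mult_at_top[OF s_lim assms(1) l_lim])
    then have "(\<lambda>n. C\<^sup>2 / (?s n * ?l n)) \<longlonglongrightarrow> 0"
      by (intro real_tendsto_divide_at_top[OF tendsto_const])
    then show ?thesis using tendsto_diff[OF tendsto_const[of "1::real"]] by fastforce
  qed
  show "(\<lambda>n. worst_power \<alpha> 4 n (d n) (?V n)) \<longlonglongrightarrow> 1"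
    by (rule tendsto_sandwich[OF _ _ p_lim tendsto_const]) (use bounds in \<open>auto elim: eventually_mono\<close>)
qed simp

end
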